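(* (Reutenauer's theorem, local version.) Let $\Sigma$ be a finite alphabet, let $(X,M)$, $(Y,N)$ be Boolean spaces with internal monoids, and let $\phi_1\colon(\beta(\Sigma^* ),\Sigma^* )\to(X,M)$ and $\phi_2\colon(\beta(\Sigma^* ),\Sigma^* )\to(Y,N)$ be morphisms. Let $\mathcal{L}$ be the Boolean algebra of subsets of $\Sigma^*$ generated by all languages of the form $L_1$, $L_2$ and $L_1aL_2$, where $L_1$ is recognised by $\phi_1$, $L_2$ is recognised by $\phi_2$, and $a\in\Sigma$. Then a language $L\subseteq\Sigma^*$ is recognised by the continuous map \[ \langle\langle\zeta_a\rangle_{a\in\Sigma},\phi_1,\phi_2\rangle\colon\beta(\Sigma^* )\to\mathcal{V}(X\times Y)^{\Sigma}\times X\times Y \] (in the sense that $\widehat{L}$ is the preimage of a clopen subset of the codomain) if, and only if, $L\in\mathcal{L}$.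
   Context: A Boolean space is a compact Hausdorff space with a clopen basis. A Boolean space with an internal monoid is a pair $(X,M)$: $X$ a Boolean space, $M\subseteq X$ a dense subspace with a monoid structure, and compatible left and right actions of $M$ on $X$ with continuous components extending left/right multiplication of $M$ on itself. A morphism $(X,M)\to(Y,N)$ is a continuous $f\colon X\to Y$ restricting to a monoid morphism $M\to N$. For a set $S$, $\beta(S)$ is the Stone–Čech compactification of discrete $S$ (ultrafilters on $\mathcal{P}(S)$, basic clopens $\widehat{L}=\{\mu\mid L\in\mu\}$, $S$ identified with principal ultrafilters); for $f\colon S\to T$, $\beta f(\mu)=\{L\subseteq T\mid f^{-1}(L)\in\mu\}$. $(\beta(\Sigma^* ),\Sigma^* )$ is a Boolean space with internal monoid via continuous extensions of concatenation. A language $L$ is recognised by a morphism $\phi\colon(\beta(\Sigma^* ),\Sigma^* )\to(X,M)$ if $\widehat{L}=\phi^{-1}(C)$ for some clopen $C\subseteq X$. The Vietoris space $\mathcal{V}(Z)$ is the set of closed subsets of $Z$ with topology generated by $\Box V=\{K\mid K\subseteq V\}$ and $\Diamond V=\{K\mid K\cap V\ne\emptyset\}$, $V$ clopen. For $a\in\Sigma$, let $c\colon\Sigma^*\times\{a\}\times\Sigma^*\to\Sigma^*$, $(u,a,v)\mapsto uav$, and let $\phi_1\times\phi_2\colon\beta(\Sigma^*\times\{a\}\times\Sigma^* )\to X\times Y$ be the unique continuous extension of $(u,a,v)\mapsto(\phi_1(u),\phi_2(v))$. Then $\zeta_a\colon\beta(\Sigma^* )\to\mathcal{V}(X\times Y)$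 is the continuous map $\zeta_a(\mu)=(\phi_1\times\phi_2)[(\beta c)^{-1}(\mu)]$; on words it is $w\mapsto\{(\phi_1(u),\phi_2(v))\mid u,v\in\Sigma^*,\ w=uav\}$. *)

theory Defs
  imports "HOL-Analysis.Analysis" "HOL-Algebra.Group"
begin

definition clopenin :: "'a topology \<Rightarrow> 'a set \<Rightarrow> bool" where
  "clopenin X U \<longleftrightarrow> openin X U \<and> closedin X U"

definition boolean_space :: "'a topology \<Rightarrow> bool" where
  "boolean_space X \<longleftrightarrow>
     compact_space X \<and> Hausdorff_space X \<and> openin X = arbitrary union_of (clopenin X)"

text \<open>The two actions are parameters; by density of the monoid in a Hausdorff space they are
  determined by their being continuous extensions of the multiplication.\<close>

locale boolean_space_internal_monoid = monoid M
  for X :: "'x topology" and M :: "'x monoid" (structure)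
    and lact :: "'x \<Rightarrow> 'x \<Rightarrow> 'x" and ract :: "'x \<Rightarrow> 'x \<Rightarrow> 'x" +
  assumes boolean: "boolean_space X"
    and carrier_subset: "carrier M \<subseteq> topspace X"
    and dense: "X closure_of (carrier M) = topspace X"
    and lact_continuous: "m \<in> carrier M \<Longrightarrow> continuous_map X X (\<lambda>x. lact m x)"
    and lact_one: "x \<in> topspace X \<Longrightarrow> lact \<one> x = x"
    and lact_mult: "\<lbrakk>m \<in> carrier M; n \<in> carrier M; x \<in> topspace X\<rbrakk>
        \<Longrightarrow> lact (m \<otimes> n) x = lact m (lact n x)"
    and lact_extends: "\<lbrakk>m \<in> carrier M; n \<in> carrier M\<rbrakk> \<Longrightarrow> lact m n = m \<otimes> n"
    and ract_continuous: "m \<in> carrier M \<Longrightarrow> continuous_map X X (\<lambda>x. ract x m)"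
    and ract_one: "x \<in> topspace X \<Longrightarrow> ract x \<one> = x"
    and ract_mult: "\<lbrakk>m \<in> carrier M; n \<in> carrier M; x \<in> topspace X\<rbrakk>
        \<Longrightarrow> ract x (m \<otimes> n) = ract (ract x m) n"
    and ract_extends: "\<lbrakk>m \<in> carrier M; n \<in> carrier M\<rbrakk> \<Longrightarrow> ract n m = n \<otimes> m"
    and compatible: "\<lbrakk>m \<in> carrier M; n \<in> carrier M; x \<in> topspace X\<rbrakk>
        \<Longrightarrow> lact m (ract x n) = ract (lact m x) n"

text \<open>\<^const>\<open>hom\<close> only requires compatibility with multiplication, so preservation of the unit is
  stated separately.\<close>

definition internal_monoid_morphism ::
    "'x topology \<Rightarrow> 'x monoid \<Rightarrow> 'y topology \<Rightarrow> 'y monoid \<Rightarrow> ('x \<Rightarrow> 'y) \<Rightarrow> bool" where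
  "internal_monoid_morphism X M Y N f \<longleftrightarrow>
     continuous_map X Y f \<and> f \<in> hom M N \<and> f \<one>\<^bsub>M\<^esub> = \<one>\<^bsub>N\<^esub>"

definition ultrafilters :: "'s set \<Rightarrow> 's set set set" where
  "ultrafilters S = {\<mu>. \<mu> \<subseteq> Pow S \<and> S \<in> \<mu> \<and> {} \<notin> \<mu> \<and>
     (\<forall>K L. K \<in> \<mu> \<and> K \<subseteq> L \<and> L \<subseteq> S \<longrightarrow> L \<in> \<mu>) \<and>
     (\<forall>K L. K \<in> \<mu> \<and> L \<in> \<mu> \<longrightarrow> K \<inter> L \<in> \<mu>) \<and>
     (\<forall>L. L \<subseteq> S \<longrightarrow> L \<in> \<mu> \<or> S - L \<in> \<mu>)}"

definition hat :: "'s set \<Rightarrow> 's set \<Rightarrow> 's set set set" where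
  "hat S L = {\<mu> \<in> ultrafilters S. L \<in> \<mu>}"

definition beta :: "'s set \<Rightarrow> 's set set topology" where
  "beta S = topology_generated_by (hat S ` Pow S)"

definition principal :: "'s set \<Rightarrow> 's \<Rightarrow> 's set set" where
  "principal S s = {L. L \<subseteq> S \<and> s \<in> L}"

definition beta_map :: "'s set \<Rightarrow> 't set \<Rightarrow> ('s \<Rightarrow> 't) \<Rightarrow> 's set set \<Rightarrow> 't set set" where
  "beta_map S T f \<mu> = {L. L \<subseteq> T \<and> {s \<in> S. f s \<in> L} \<in> \<mu>}"

text \<open>The unique continuous extension of \<open>f\<close> along \<^term>\<open>principal S\<close>; extensionality fixes
  the irrelevant values outside the space, so that the description is unique.\<close>

definition beta_extension :: "'s set \<Rightarrow> 'z topology \<Rightarrow> ('s \<Rightarrow> 'z) \<Rightarrow> 's set set \<Rightarrow> 'z" where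
  "beta_extension S Z f = (THE g. g \<in> extensional (topspace (beta S)) \<and>
     continuous_map (beta S) Z g \<and> (\<forall>s\<in>S. g (principal S s) = f s))"

text \<open>The free monoid on \<open>A\<close>, transported to the principal ultrafilters on the set of words.\<close>

definition word_of :: "'a set \<Rightarrow> 'a list set set \<Rightarrow> 'a list" where
  "word_of A = inv_into (lists A) (principal (lists A))"

definition word_monoid :: "'a set \<Rightarrow> 'a list set set monoid" where
  "word_monoid A = \<lparr>carrier = principal (lists A) ` lists A,
     mult = (\<lambda>\<mu> \<nu>. principal (lists A) (word_of A \<mu> @ word_of A \<nu>)),
     one = principal (lists A) []\<rparr>"

definition recognised_by ::
    "'a set \<Rightarrow> 'z topology \<Rightarrow> ('a list set set \<Rightarrow> 'z) \<Rightarrow> 'a list set \<Rightarrow> bool" where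
  "recognised_by A Z \<phi> L \<longleftrightarrow> L \<subseteq> lists A \<and>
     (\<exists>C. clopenin Z C \<and> hat (lists A) L = {\<mu> \<in> topspace (beta (lists A)). \<phi> \<mu> \<in> C})"

definition vietoris_box :: "'z topology \<Rightarrow> 'z set \<Rightarrow> 'z set set" where
  "vietoris_box Z V = {K. closedin Z K \<and> K \<subseteq> V}"

definition vietoris_diamond :: "'z topology \<Rightarrow> 'z set \<Rightarrow> 'z set set" where
  "vietoris_diamond Z V = {K. closedin Z K \<and> K \<inter> V \<noteq> {}}"

definition vietoris :: "'z topology \<Rightarrow> 'z set topology" where
  "vietoris Z = topology_generated_by
     (vietoris_box Z ` {V. clopenin Z V} \<union> vietoris_diamond Z ` {V. clopenin Z V})"

definition marked_words :: "'a set \<Rightarrow> 'a \<Rightarrow> ('a list \<times> 'a \<times> 'a list) set" where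
  "marked_words A a = lists A \<times> {a} \<times> lists A"

definition unmark :: "'a list \<times> 'a \<times> 'a list \<Rightarrow> 'a list" where
  "unmark = (\<lambda>(u, a, v). u @ [a] @ v)"

definition pair_extension ::
    "'a set \<Rightarrow> 'x topology \<Rightarrow> 'y topology \<Rightarrow> ('a list set set \<Rightarrow> 'x) \<Rightarrow> ('a list set set \<Rightarrow> 'y) \<Rightarrow>
     'a \<Rightarrow> ('a list \<times> 'a \<times> 'a list) set set \<Rightarrow> 'x \<times> 'y" where
  "pair_extension A X Y \<phi>\<^sub>1 \<phi>\<^sub>2 a = beta_extension (marked_words A a) (prod_topology X Y)
     (\<lambda>(u, _, v). (\<phi>\<^sub>1 (principal (lists A) u), \<phi>\<^sub>2 (principal (lists A) v)))"

definition zeta ::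
    "'a set \<Rightarrow> 'x topology \<Rightarrow> 'y topology \<Rightarrow> ('a list set set \<Rightarrow> 'x) \<Rightarrow> ('a list set set \<Rightarrow> 'y) \<Rightarrow>
     'a \<Rightarrow> 'a list set set \<Rightarrow> ('x \<times> 'y) set" where
  "zeta A X Y \<phi>\<^sub>1 \<phi>\<^sub>2 a \<mu> = pair_extension A X Y \<phi>\<^sub>1 \<phi>\<^sub>2 a `
     {\<nu> \<in> topspace (beta (marked_words A a)).
        beta_map (marked_words A a) (lists A) unmark \<nu> = \<mu>}"

definition reutenauer_space ::
    "'a set \<Rightarrow> 'x topology \<Rightarrow> 'y topology \<Rightarrow> (('a \<Rightarrow> ('x \<times> 'y) set) \<times> 'x \<times> 'y) topology" where
  "reutenauer_space A X Y = prod_topology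
     (product_topology (\<lambda>_. vietoris (prod_topology X Y)) A) (prod_topology X Y)"

definition reutenauer_map ::
    "'a set \<Rightarrow> 'x topology \<Rightarrow> 'y topology \<Rightarrow> ('a list set set \<Rightarrow> 'x) \<Rightarrow> ('a list set set \<Rightarrow> 'y) \<Rightarrow>
     'a list set set \<Rightarrow> ('a \<Rightarrow> ('x \<times> 'y) set) \<times> 'x \<times> 'y" where
  "reutenauer_map A X Y \<phi>\<^sub>1 \<phi>\<^sub>2 \<mu> = (\<lambda>a\<in>A. zeta A X Y \<phi>\<^sub>1 \<phi>\<^sub>2 a \<mu>, \<phi>\<^sub>1 \<mu>, \<phi>\<^sub>2 \<mu>)"

definition marked_product :: "'a list set \<Rightarrow> 'a \<Rightarrow> 'a list set \<Rightarrow> 'a list set" where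
  "marked_product L\<^sub>1 a L\<^sub>2 = {u @ [a] @ v |u v. u \<in> L\<^sub>1 \<and> v \<in> L\<^sub>2}"

definition reutenauer_algebra ::
    "'a set \<Rightarrow> 'x topology \<Rightarrow> 'y topology \<Rightarrow> ('a list set set \<Rightarrow> 'x) \<Rightarrow> ('a list set set \<Rightarrow> 'y) \<Rightarrow>
     'a list set set" where
  "reutenauer_algebra A X Y \<phi>\<^sub>1 \<phi>\<^sub>2 = algebra (lists A) hull
     ({L\<^sub>1. recognised_by A X \<phi>\<^sub>1 L\<^sub>1} \<union> {L\<^sub>2. recognised_by A Y \<phi>\<^sub>2 L\<^sub>2} \<union>
      {marked_product L\<^sub>1 a L\<^sub>2 |L\<^sub>1 a L\<^sub>2.
         recognised_by A X \<phi>\<^sub>1 L\<^sub>1 \<and> a \<in> A \<and> recognised_by A Y \<phi>\<^sub>2 L\<^sub>2})"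

lemma topspace_beta: "topspace (beta S) = ultrafilters S"
proof -
  have "(\<Union>L\<in>Pow S. hat S L) = ultrafilters S"
    unfolding hat_def ultrafilters_def by auto
  then show ?thesis
    by (simp add: beta_def topology_generated_by_topspace)
qed

lemma topspace_vietoris: "topspace (vietoris Z) = {K. closedin Z K}"
proof -
  have "vietoris_box Z (topspace Z) = {K. closedin Z K}"
    using closedin_subset by (auto simp: vietoris_box_def)
  moreover have "clopenin Z (topspace Z)"
    by (simp add: clopenin_def)
  ultimately show ?thesis
    unfolding vietoris_def topology_generated_by_topspace
    by (auto simp: vietoris_box_def vietoris_diamond_def)
qed

lemma inj_on_principal: "inj_on (principal S) S"
proof (rule inj_onI)
  fix s t assume s: "s \<in> S" and eq: "principal S s = principal S t"
  from s have "{s} \<in> principal S s"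
    by (simp add: principal_def)
  then have "{s} \<in> principal S t"
    by (simp only: eq)
  then show "s = t"
    by (simp add: principal_def)
qed

lemma word_of_principal: "u \<in> lists A \<Longrightarrow> word_of A (principal (lists A) u) = u"
  unfolding word_of_def by (rule inv_into_f_f[OF inj_on_principal])

lemma word_monoid_mult:
  assumes "u \<in> lists A" "v \<in> lists A"
  shows "principal (lists A) u \<otimes>\<^bsub>word_monoid A\<^esub> principal (lists A) v = principal (lists A) (u @ v)"
  unfolding word_monoid_def by (simp only: monoid.simps word_of_principal[OF assms(1)] word_of_principal[OF assms(2)])

lemma monoid_word_monoid: "monoid (word_monoid A)"
proof -
  have carr: "carrier (word_monoid A) = principal (lists A) ` lists A"
    and one: "\<one>\<^bsub>word_monoid A\<^esub> = principal (lists A) []"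
    by (simp_all add: word_monoid_def)
  have app: "u @ v \<in> lists A" if "u \<in> lists A" "v \<in> lists A" for u v
    using that by (simp add: append_in_lists_conv)
  show ?thesis
  proof (rule monoidI, unfold carr one)
    show "principal (lists A) [] \<in> principal (lists A) ` lists A"
      by (rule imageI) (rule lists.Nil)
  qed (elim imageE, simp only: word_monoid_mult app lists.Nil append_assoc append_Nil append_Nil2 imageI)+
qed

end

theory Submission
  imports Defs
begin

text \<open>
  For every Boolean algebra \<open>\<A>\<close> of subsets of \<open>S\<close> the sets \<open>hat S K\<close> with \<open>K \<in> \<A>\<close> are the base of a
  compact topology on the ultrafilters, whose clopen sets are exactly these sets. So recognition
  implies membership in the algebra once the map is continuous for that coarser topology.
  For \<open>\<zeta>\<close> this rests on the equivalence of \<open>\<zeta>\<^sub>a \<mu> \<inter> V \<noteq> {}\<close>, for \<open>V\<close> clopen, with the membership in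
  \<open>\<mu>\<close> of the language of all \<open>uav\<close> with \<open>(\<phi>\<^sub>1 u, \<phi>\<^sub>2 v) \<in> V\<close>, since \<open>V\<close> is a finite union of clopen
  rectangles and a rectangle yields a marked product of recognised languages. The same equivalence,
  applied to one rectangle, shows that marked products are recognised.
\<close>

section \<open>Ultrafilters\<close>

lemma ultrafilter_subset:
  assumes "\<mu> \<in> ultrafilters S" "L \<in> \<mu>"
  shows "L \<subseteq> S"
proof -
  have "\<mu> \<subseteq> Pow S" using assms(1) by (simp add: ultrafilters_def)
  then show ?thesis using assms(2) by blast
qed

lemma ultrafilter_space: "\<mu> \<in> ultrafilters S \<Longrightarrow> S \<in> \<mu>"
  by (simp add: ultrafilters_def)

lemma ultrafilter_empty: "\<mu> \<in> ultrafilters S \<Longrightarrow> {} \<notin> \<mu>"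
  by (simp add: ultrafilters_def)

lemma ultrafilter_upward:
  assumes "\<mu> \<in> ultrafilters S" "K \<in> \<mu>" "K \<subseteq> L" "L \<subseteq> S"
  shows "L \<in> \<mu>"
proof -
  have "\<forall>K L. K \<in> \<mu> \<and> K \<subseteq> L \<and> L \<subseteq> S \<longrightarrow> L \<in> \<mu>"
    using assms(1) unfolding ultrafilters_def mem_Collect_eq by (elim conjE)
  then show ?thesis using assms(2-4) by iprover
qed

lemma ultrafilter_Int: "\<mu> \<in> ultrafilters S \<Longrightarrow> K \<in> \<mu> \<Longrightarrow> L \<in> \<mu> \<Longrightarrow> K \<inter> L \<in> \<mu>"
  by (simp add: ultrafilters_def)

lemma ultrafilter_Int_iff:
  assumes "\<mu> \<in> ultrafilters S" "K \<subseteq> S" "L \<subseteq> S"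
  shows "K \<inter> L \<in> \<mu> \<longleftrightarrow> K \<in> \<mu> \<and> L \<in> \<mu>"
proof
  assume "K \<inter> L \<in> \<mu>"
  then show "K \<in> \<mu> \<and> L \<in> \<mu>"
    using ultrafilter_upward[OF assms(1) _ Int_lower1 assms(2)]
      ultrafilter_upward[OF assms(1) _ Int_lower2 assms(3)] by blast
qed (simp add: ultrafilter_Int[OF assms(1)])

lemma ultrafilter_Diff_iff:
  assumes "\<mu> \<in> ultrafilters S" "L \<subseteq> S"
  shows "S - L \<in> \<mu> \<longleftrightarrow> L \<notin> \<mu>"
proof
  assume "S - L \<in> \<mu>"
  show "L \<notin> \<mu>"
  proof
    assume "L \<in> \<mu>"
    then have "L \<inter> (S - L) \<in> \<mu>"
      using \<open>S - L \<in> \<mu>\<close> by (rule ultrafilter_Int[OF assms(1)])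
    then show False using ultrafilter_empty[OF assms(1)] by simp
  qed
next
  assume "L \<notin> \<mu>"
  moreover have "\<forall>L. L \<subseteq> S \<longrightarrow> L \<in> \<mu> \<or> S - L \<in> \<mu>"
    using assms(1) by (simp add: ultrafilters_def)
  ultimately show "S - L \<in> \<mu>" using assms(2) by blast
qed

lemma ultrafilter_Un_iff:
  assumes "\<mu> \<in> ultrafilters S" "K \<subseteq> S" "L \<subseteq> S"
  shows "K \<union> L \<in> \<mu> \<longleftrightarrow> K \<in> \<mu> \<or> L \<in> \<mu>"
proof -
  have "K \<union> L \<in> \<mu> \<longleftrightarrow> S - (K \<union> L) \<notin> \<mu>"
    using ultrafilter_Diff_iff[OF assms(1), of "K \<union> L"] assms(2,3) by simp
  also have "S - (K \<union> L) = (S - K) \<inter> (S - L)" by blast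
  also have "(S - K) \<inter> (S - L) \<notin> \<mu> \<longleftrightarrow> K \<in> \<mu> \<or> L \<in> \<mu>"
    by (simp add: ultrafilter_Int_iff[OF assms(1)] ultrafilter_Diff_iff[OF assms(1)] assms(2,3))
  finally show ?thesis .
qed

text \<open>A set in \<nu> has its complement outside \<nu>, hence outside \<mu>, so \<mu> contains
  the set. This later turns an inclusion into a pushforward into an equation.\<close>

lemma ultrafilter_maximal:
  assumes "\<mu> \<in> ultrafilters S" "\<nu> \<in> ultrafilters S" "\<mu> \<subseteq> \<nu>"
  shows "\<nu> = \<mu>"
proof (intro equalityI subsetI)
  fix L assume L: "L \<in> \<nu>"
  then have "S - L \<notin> \<mu>"
    using assms(3) ultrafilter_Diff_iff[OF assms(2) ultrafilter_subset[OF assms(2) L]] by blast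
  then show "L \<in> \<mu>"
    using ultrafilter_Diff_iff[OF assms(1) ultrafilter_subset[OF assms(2) L]] by blast
qed (use assms(3) in blast)

lemma principal_ultrafilter: "s \<in> S \<Longrightarrow> principal S s \<in> ultrafilters S"
  unfolding principal_def ultrafilters_def by auto

section \<open>Extension of families of sets to ultrafilters\<close>

text \<open>Intersecting with \<open>S\<close> gives the empty family a meaning: for
  \<open>H = {}\<close> the condition says that \<open>S\<close> is non-empty, without which there
  is no ultrafilter on \<open>S\<close>.\<close>

definition finite_intersection_property :: "'s set \<Rightarrow> 's set set \<Rightarrow> bool" where
  "finite_intersection_property S F \<longleftrightarrow> (\<forall>H. finite H \<and> H \<subseteq> F \<longrightarrow> S \<inter> \<Inter>H \<noteq> {})"

lemma finite_intersection_property_insert: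
  assumes "finite_intersection_property S F" "L \<subseteq> S"
  shows "finite_intersection_property S (insert L F) \<or>
    finite_intersection_property S (insert (S - L) F)"
proof (rule ccontr)
  assume neither: "\<not> ?thesis"
  then obtain H1 where H1: "finite H1" "H1 \<subseteq> insert L F" "S \<inter> \<Inter>H1 = {}"
    by (auto simp: finite_intersection_property_def simp del: Int_Inter_eq)
  from neither obtain H2 where H2: "finite H2" "H2 \<subseteq> insert (S - L) F" "S \<inter> \<Inter>H2 = {}"
    by (auto simp: finite_intersection_property_def simp del: Int_Inter_eq)
  \<comment> \<open>Dropping the two new sets leaves a finite subfamily of \<open>F\<close>. Its
    common point lies in \<open>L\<close> or in the complement, so in all members of
    \<open>H1\<close> or of \<open>H2\<close>.\<close>
  let ?H = "(H1 - {L}) \<union> (H2 - {S - L})"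
  have "finite ?H" using H1(1) H2(1) by simp
  moreover have "?H \<subseteq> F" using H1(2) H2(2) by blast
  ultimately have "S \<inter> \<Inter>?H \<noteq> {}"
    using assms(1) unfolding finite_intersection_property_def by simp
  then obtain s where s: "s \<in> S" "s \<in> \<Inter>?H" by blast
  have "s \<in> \<Inter>H1" if "s \<in> L" using that s(2) by blast
  moreover have "s \<in> \<Inter>H2" if "s \<notin> L" using that s by blast
  ultimately show False using H1(3) H2(3) s(1) by blast
qed

text \<open>Zorn's lemma gives a maximal family with the property above \<open>F\<close>. By
  \<open>finite_intersection_property_insert\<close> it decides every subset of \<open>S\<close>; a
  violation of another ultrafilter law would exhibit finitely many members without a common
  point.\<close>

lemma ultrafilter_extension:
  assumes "F \<subseteq> Pow S" and "finite_intersection_property S F"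
  shows "\<exists>\<nu>\<in>ultrafilters S. F \<subseteq> \<nu>"
proof -
  define \<F> where
    "\<F> = {G. F \<subseteq> G \<and> G \<subseteq> Pow S \<and> finite_intersection_property S G}"
  have "\<Union>\<C> \<in> \<F>" if ne: "\<C> \<noteq> {}" and chain: "subset.chain \<F> \<C>" for \<C>
  proof -
    have sub: "\<C> \<subseteq> \<F>" using chain by (simp add: subset.chain_def)
    have "S \<inter> \<Inter>H \<noteq> {}" if H: "finite H" "H \<subseteq> \<Union>\<C>" for H
    proof -
      obtain B where B: "B \<in> \<C>" "H \<subseteq> B"
        by (rule finite_subset_Union_chain[OF H ne chain])
      then have "finite_intersection_property S B" using sub by (auto simp: \<F>_def)
      then show ?thesis
        using H(1) B(2) by (simp add: finite_intersection_property_def)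
    qed
    then have "finite_intersection_property S (\<Union>\<C>)"
      by (simp add: finite_intersection_property_def)
    moreover have "F \<subseteq> G" "G \<subseteq> Pow S" if "G \<in> \<C>" for G
      using subsetD[OF sub that] by (simp_all add: \<F>_def)
    then have "F \<subseteq> \<Union>\<C>" "\<Union>\<C> \<subseteq> Pow S" using ne by fast+
    ultimately show ?thesis by (simp add: \<F>_def)
  qed
  moreover have "F \<in> \<F>" using assms by (simp add: \<F>_def)
  then have "\<F> \<noteq> {}" by blast
  ultimately have "\<exists>M\<in>\<F>. \<forall>G\<in>\<F>. M \<subseteq> G \<longrightarrow> G = M"
    by (rule subset_Zorn_nonempty[rotated])
  then obtain \<nu> where \<nu>: "\<nu> \<in> \<F>" and max: "\<And>G. G \<in> \<F> \<Longrightarrow> \<nu> \<subseteq> G \<Longrightarrow> G = \<nu>"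
    by metis
  have F\<nu>: "F \<subseteq> \<nu>" and pow: "\<nu> \<subseteq> Pow S" and fip: "finite_intersection_property S \<nu>"
    using \<nu> by (simp_all add: \<F>_def)
  have total: "L \<in> \<nu> \<or> S - L \<in> \<nu>" if "L \<subseteq> S" for L
  proof -
    have "K \<in> \<nu>" if "K \<subseteq> S" "finite_intersection_property S (insert K \<nu>)" for K
    proof -
      have "insert K \<nu> \<in> \<F>" using that F\<nu> pow by (auto simp: \<F>_def)
      then show ?thesis using max[of "insert K \<nu>"] by blast
    qed
    then show ?thesis
      using finite_intersection_property_insert[OF fip that] that Diff_subset by metis
  qed
  have meet: "S \<inter> \<Inter>H \<noteq> {}" if "finite H" "H \<subseteq> \<nu>" for H
    using fip that by (simp add: finite_intersection_property_def)
  have empty: "{} \<notin> \<nu>" using meet[of "{{}}"] by auto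
  have up: "L \<in> \<nu>" if "K \<in> \<nu>" "K \<subseteq> L" "L \<subseteq> S" for K L
  proof (rule ccontr)
    assume "L \<notin> \<nu>"
    then have "S \<inter> \<Inter>{K, S - L} \<noteq> {}" using total[OF that(3)] that(1) by (intro meet) auto
    then show False using that(2) by blast
  qed
  have int: "K \<inter> L \<in> \<nu>" if "K \<in> \<nu>" "L \<in> \<nu>" for K L
  proof (rule ccontr)
    assume "K \<inter> L \<notin> \<nu>"
    moreover have "K \<inter> L \<subseteq> S" using pow that by blast
    ultimately have "S - K \<inter> L \<in> \<nu>" using total by blast
    then have "S \<inter> \<Inter>{K, L, S - K \<inter> L} \<noteq> {}" using that by (intro meet) auto
    then show False by blast
  qed
  have "S \<in> \<nu>" using total[of S] empty by simp
  then have "\<nu> \<in> ultrafilters S"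
    unfolding ultrafilters_def mem_Collect_eq
    by (intro conjI allI impI pow empty) (simp_all add: total int, elim conjE, rule up)
  then show ?thesis using F\<nu> by blast
qed

section \<open>Boolean operations on the basic clopen sets\<close>

text \<open>The principal ultrafilters at the points of \<open>K\<close> detect the inclusion. The
  resulting injectivity of \<open>hat\<close> recovers a language from its clopen set.\<close>

lemma hat_subset_iff:
  assumes "K \<subseteq> S" "L \<subseteq> S"
  shows "hat S K \<subseteq> hat S L \<longleftrightarrow> K \<subseteq> L"
proof
  assume sub: "hat S K \<subseteq> hat S L"
  show "K \<subseteq> L"
  proof
    fix s assume s: "s \<in> K"
    then have "principal S s \<in> hat S K"
      using assms principal_ultrafilter[of s S] by (auto simp: hat_def principal_def)
    then have "principal S s \<in> hat S L" using sub by blast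
    then show "s \<in> L" by (simp add: hat_def principal_def)
  qed
next
  assume "K \<subseteq> L"
  then show "hat S K \<subseteq> hat S L"
    using ultrafilter_upward[of _ S K L] assms(2) by (auto simp: hat_def)
qed

lemma hat_eq_iff: "K \<subseteq> S \<Longrightarrow> L \<subseteq> S \<Longrightarrow> hat S K = hat S L \<longleftrightarrow> K = L"
  by (simp add: set_eq_subset hat_subset_iff)

lemma hat_Int: "K \<subseteq> S \<Longrightarrow> L \<subseteq> S \<Longrightarrow> hat S (K \<inter> L) = hat S K \<inter> hat S L"
  by (auto simp: hat_def ultrafilter_Int_iff)

lemma hat_Un: "K \<subseteq> S \<Longrightarrow> L \<subseteq> S \<Longrightarrow> hat S (K \<union> L) = hat S K \<union> hat S L"
  by (auto simp: hat_def ultrafilter_Un_iff)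

lemma hat_Diff: "L \<subseteq> S \<Longrightarrow> hat S (S - L) = ultrafilters S - hat S L"
  by (auto simp: hat_def ultrafilter_Diff_iff)

lemma hat_space: "hat S S = ultrafilters S"
  using ultrafilter_space by (auto simp: hat_def)

lemma hat_empty: "hat S {} = {}"
  by (auto simp: hat_def ultrafilters_def)

text \<open>Ultrafilters are prime for finite unions only: a non-principal one contains
  \<open>S\<close>, a union of singletons, but no singleton.\<close>

lemma hat_Union:
  assumes "finite \<K>" "\<K> \<subseteq> Pow S"
  shows "hat S (\<Union>\<K>) = (\<Union>K\<in>\<K>. hat S K)"
  using assms
proof (induction \<K> rule: finite_induct)
  case (insert K \<K>)
  then have "K \<subseteq> S" "\<Union>\<K> \<subseteq> S" by auto
  then show ?case using hat_Un[of K S "\<Union>\<K>"] insert by simp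
qed (simp add: hat_empty)

section \<open>The topology generated by a Boolean algebra of subsets\<close>

text \<open>For an algebra \<A> this is the Stone topology of \<A>, except that ultrafilters on
  \<open>S\<close> with the same trace on \<A> stay distinct points, so it need not be Hausdorff.
  All algebras thus share one carrier.\<close>

definition hat_topology :: "'s set \<Rightarrow> 's set set \<Rightarrow> 's set set topology" where
  "hat_topology S \<A> = topology_generated_by (hat S ` \<A>)"

lemma beta_eq_hat_topology: "beta S = hat_topology S (Pow S)"
  by (simp add: beta_def hat_topology_def)

lemma openin_hat_topology: "K \<in> \<A> \<Longrightarrow> openin (hat_topology S \<A>) (hat S K)"
  unfolding hat_topology_def by (rule topology_generated_by_Basis) blast

lemma topspace_hat_topology:
  assumes "S \<in> \<A>"
  shows "topspace (hat_topology S \<A>) = ultrafilters S"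
proof -
  have "\<Union>(hat S ` \<A>) \<subseteq> ultrafilters S" by (auto simp: hat_def)
  moreover have "ultrafilters S \<subseteq> \<Union>(hat S ` \<A>)"
    using UN_upper[OF assms, of "hat S"] by (simp only: hat_space)
  ultimately show ?thesis by (simp add: hat_topology_def)
qed

text \<open>\<open>hat\<close> preserves intersections and \<A> is closed under them, so the subbase
  is a base.\<close>

lemma openin_hat_topology_contains_hat:
  assumes "algebra S \<A>" "openin (hat_topology S \<A>) U" "\<nu> \<in> U"
  shows "\<exists>K\<in>\<A>. \<nu> \<in> hat S K \<and> hat S K \<subseteq> U"
proof -
  interpret algebra S \<A> by fact
  \<comment> \<open>The induction below has a case called \<open>Int\<close> whose facts hide the
    closure rule of the algebra.\<close>
  note inter = Int
  have "generate_topology_on (hat S ` \<A>) U"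
    using assms(2) unfolding hat_topology_def by (rule openin_topology_generated_by)
  then show ?thesis using assms(3)
  proof (induction arbitrary: \<nu>)
    case (Int U V)
    then have "\<nu> \<in> U" "\<nu> \<in> V" by auto
    from Int.IH(1)[OF this(1)] Int.IH(2)[OF this(2)]
    obtain K L where K: "K \<in> \<A>" "\<nu> \<in> hat S K" "hat S K \<subseteq> U"
      and L: "L \<in> \<A>" "\<nu> \<in> hat S L" "hat S L \<subseteq> V" by blast
    have "hat S (K \<inter> L) = hat S K \<inter> hat S L"
      using hat_Int[OF sets_into_space[OF K(1)] sets_into_space[OF L(1)]] .
    then show ?case
      using K(2,3) L(2,3) inter[OF K(1) L(1)] by (intro bexI[of _ "K \<inter> L"]) blast+
  next
    case (UN \<K>)
    then obtain U where U: "U \<in> \<K>" "\<nu> \<in> U" by blast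
    from UN.IH[OF this] obtain K where "K \<in> \<A>" "\<nu> \<in> hat S K" "hat S K \<subseteq> U" by blast
    then show ?case using U(1) by blast
  next
    case (Basis V)
    then show ?case by blast
  qed blast
qed

text \<open>If no finitely many base sets subordinate to the cover sufficed, their complements would
  lie in a common ultrafilter, which no member of the cover could contain.\<close>

lemma compact_space_hat_topology:
  assumes "algebra S \<A>"
  shows "compact_space (hat_topology S \<A>)"
proof -
  interpret algebra S \<A> by fact
  have top: "topspace (hat_topology S \<A>) = ultrafilters S"
    by (rule topspace_hat_topology) simp
  have cover: "\<exists>\<F>. finite \<F> \<and> \<F> \<subseteq> \<U> \<and> ultrafilters S \<subseteq> \<Union>\<F>"
    if op: "\<And>U. U \<in> \<U> \<Longrightarrow> openin (hat_topology S \<A>) U" and cover: "ultrafilters S \<subseteq> \<Union>\<U>"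
    for \<U>
  proof -
    define \<K> where "\<K> = {K \<in> \<A>. \<exists>U\<in>\<U>. hat S K \<subseteq> U}"
    have "\<not> finite_intersection_property S ((-) S ` \<K>)"
    proof
      assume "finite_intersection_property S ((-) S ` \<K>)"
      then obtain \<nu> where \<nu>: "\<nu> \<in> ultrafilters S" and sub: "(-) S ` \<K> \<subseteq> \<nu>"
        using ultrafilter_extension[of "(-) S ` \<K>" S] by blast
      then obtain U where U: "U \<in> \<U>" "\<nu> \<in> U" using cover by blast
      then obtain K where K: "K \<in> \<A>" "\<nu> \<in> hat S K" "hat S K \<subseteq> U"
        using openin_hat_topology_contains_hat[OF assms op] by metis
      then have "K \<in> \<K>" using U by (auto simp: \<K>_def)
      then have "S - K \<in> \<nu>" using sub by blast
      moreover have "K \<in> \<nu>" using K(2) by (simp add: hat_def)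
      ultimately show False
        using ultrafilter_Diff_iff[OF \<nu> sets_into_space[OF K(1)]] by simp
    qed
    then obtain H where H: "finite H" "H \<subseteq> (-) S ` \<K>" "S \<inter> \<Inter>H = {}"
      unfolding finite_intersection_property_def by blast
    then obtain \<K>' where \<K>': "finite \<K>'" "\<K>' \<subseteq> \<K>" "H = (-) S ` \<K>'"
      by (meson finite_subset_image)
    have pow: "\<K>' \<subseteq> Pow S" using \<K>'(2) sets_into_space by (auto simp: \<K>_def)
    have "\<Union>\<K>' = S" using H(3) pow unfolding \<K>'(3) by auto
    then have all: "ultrafilters S \<subseteq> (\<Union>K\<in>\<K>'. hat S K)"
      using hat_Union[OF \<K>'(1) pow] hat_space[of S] by simp
    have "\<forall>K\<in>\<K>'. \<exists>U\<in>\<U>. hat S K \<subseteq> U" using \<K>'(2) by (auto simp: \<K>_def)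
    then obtain f where f: "\<And>K. K \<in> \<K>' \<Longrightarrow> f K \<in> \<U>" "\<And>K. K \<in> \<K>' \<Longrightarrow> hat S K \<subseteq> f K"
      by metis
    have "(\<Union>K\<in>\<K>'. hat S K) \<subseteq> \<Union>(f ` \<K>')" using f(2) by (rule UN_mono[OF subset_refl])
    then show ?thesis
      using \<K>'(1) all f(1) by (intro exI[of _ "f ` \<K>'"] conjI finite_imageI image_subsetI) auto
  qed
  show ?thesis
    unfolding compact_space_def compactin_def top
    by (intro conjI allI impI subset_refl) (elim conjE, rule cover, blast+)
qed

text \<open>A clopen set is compact and a union of base sets, so finitely many suffice, and
  \<open>hat_Union\<close> merges them into one.\<close>

lemma clopenin_hat_topology:
  assumes "algebra S \<A>" "clopenin (hat_topology S \<A>) C"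
  shows "C \<in> hat S ` \<A>"
proof -
  interpret algebra S \<A> by fact
  have op: "openin (hat_topology S \<A>) C" and cl: "closedin (hat_topology S \<A>) C"
    using assms(2) by (simp_all add: clopenin_def)
  define \<U> where "\<U> = hat S ` {K \<in> \<A>. hat S K \<subseteq> C}"
  have "compactin (hat_topology S \<A>) C"
    by (rule closedin_compact_space[OF compact_space_hat_topology[OF assms(1)] cl])
  moreover have "C \<subseteq> \<Union>\<U>"
    using openin_hat_topology_contains_hat[OF assms(1) op] by (fastforce simp: \<U>_def)
  moreover have "\<forall>U\<in>\<U>. openin (hat_topology S \<A>) U"
    by (auto simp: \<U>_def openin_hat_topology)
  ultimately obtain \<F> where \<F>: "finite \<F>" "\<F> \<subseteq> \<U>" "C \<subseteq> \<Union>\<F>"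
    unfolding compactin_def by metis
  then obtain \<K> where \<K>: "finite \<K>" "\<K> \<subseteq> {K \<in> \<A>. hat S K \<subseteq> C}" "\<F> = hat S ` \<K>"
    unfolding \<U>_def by (meson finite_subset_image)
  have "\<K> \<subseteq> Pow S" using \<K>(2) sets_into_space by auto
  then have "hat S (\<Union>\<K>) = \<Union>\<F>" using hat_Union[of \<K> S] \<K> by simp
  also have "\<dots> = C" using \<F>(3) \<K> by blast
  finally have "C = hat S (\<Union>\<K>)" by simp
  moreover have "\<Union>\<K> \<in> \<A>" using \<K>(1,2) by (intro finite_Union) auto
  ultimately show ?thesis by (rule image_eqI)
qed

section \<open>The Stone-Cech compactification\<close>

lemma algebra_Pow_space: "algebra S (Pow S)"
  by (simp add: algebra_iff_Un)

lemma compact_space_beta: "compact_space (beta S)"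
  unfolding beta_eq_hat_topology using algebra_Pow_space by (rule compact_space_hat_topology)

lemma openin_beta_hat: "L \<subseteq> S \<Longrightarrow> openin (beta S) (hat S L)"
  unfolding beta_eq_hat_topology by (simp add: openin_hat_topology)

lemma closedin_beta_hat:
  assumes "L \<subseteq> S"
  shows "closedin (beta S) (hat S L)"
proof -
  have "ultrafilters S - hat S L = hat S (S - L)" using hat_Diff[OF assms] by simp
  then show ?thesis
    using openin_beta_hat[of "S - L" S] by (auto simp: closedin_def topspace_beta hat_def)
qed

text \<open>A base set \<open>hat S K\<close> around \<nu> inside \<open>U\<close> contains the
  principal ultrafilters at the points of \<open>K\<close>, so the trace of \<open>U\<close> on
  \<open>S\<close> includes \<open>K\<close>.\<close>

lemma openin_beta_trace:
  assumes "openin (beta S) U" "\<nu> \<in> U"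
  shows "{s \<in> S. principal S s \<in> U} \<in> \<nu>"
proof -
  obtain K where K: "K \<subseteq> S" "\<nu> \<in> hat S K" "hat S K \<subseteq> U"
    using openin_hat_topology_contains_hat[OF algebra_Pow_space] assms
    unfolding beta_eq_hat_topology by blast
  then have "principal S s \<in> U" if "s \<in> K" for s
    using that principal_ultrafilter[of s S] by (auto simp: hat_def principal_def)
  then show ?thesis
    using K by (auto simp: hat_def intro!: ultrafilter_upward[of \<nu> S K])
qed

text \<open>\<open>V\<close> and its complement both have open preimages, to which
  \<open>openin_beta_trace\<close> applies. Their traces on \<open>S\<close> are complementary, so
  \<nu> contains exactly one of them.\<close>

lemma continuous_map_beta_clopenin_iff:
  assumes f: "continuous_map (beta S) Z f" and V: "clopenin Z V" and \<nu>: "\<nu> \<in> ultrafilters S"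
  shows "f \<nu> \<in> V \<longleftrightarrow> {s \<in> S. f (principal S s) \<in> V} \<in> \<nu>"
proof -
  have *: "{s \<in> S. f (principal S s) \<in> U} \<in> \<nu>" if "openin Z U" "f \<nu> \<in> U" for U
  proof -
    have "openin (beta S) {\<mu> \<in> topspace (beta S). f \<mu> \<in> U}"
      using f that by (rule_tac openin_continuous_map_preimage)
    from openin_beta_trace[OF this, of \<nu>] have
      "{s \<in> S. principal S s \<in> topspace (beta S) \<and> f (principal S s) \<in> U} \<in> \<nu>"
      using \<nu> that by (simp add: topspace_beta)
    then show ?thesis
      by (rule back_subst[of "\<lambda>K. K \<in> \<nu>"]) (auto simp: topspace_beta principal_ultrafilter)
  qed
  have mem: "f \<mu> \<in> topspace Z" if "\<mu> \<in> ultrafilters S" for \<mu>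
    using f that by (auto simp: continuous_map_def topspace_beta)
  have "{s \<in> S. f (principal S s) \<in> topspace Z - V} = S - {s \<in> S. f (principal S s) \<in> V}"
    using mem principal_ultrafilter by fastforce
  then show ?thesis
    using *[of V] *[of "topspace Z - V"] V mem[OF \<nu>] ultrafilter_Diff_iff[OF \<nu>]
    unfolding clopenin_def by (metis (no_types, lifting) Diff_iff mem_Collect_eq openin_diff openin_topspace subsetI)
qed

lemma principal_dense: "beta S closure_of (principal S ` S) = topspace (beta S)"
proof -
  have "\<exists>s\<in>S. principal S s \<in> U" if "\<nu> \<in> U" "openin (beta S) U" for \<nu> U
  proof -
    have "\<nu> \<in> ultrafilters S" using that openin_subset topspace_beta by blast
    moreover have "{s \<in> S. principal S s \<in> U} \<in> \<nu>" using that by (simp add: openin_beta_trace)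
    ultimately have "{s \<in> S. principal S s \<in> U} \<noteq> {}" using ultrafilter_empty by metis
    then show ?thesis by blast
  qed
  then have "\<nu> \<in> beta S closure_of (principal S ` S)" if "\<nu> \<in> topspace (beta S)" for \<nu>
    using that unfolding in_closure_of by blast
  then show ?thesis
    by (intro equalityI closure_of_subset_topspace subsetI)
qed

text \<open>Evaluates the definite description: maps into a Hausdorff space that agree on the dense
  principal ultrafilters are equal, and restriction fixes the values elsewhere.\<close>

lemma beta_extension_eq:
  assumes "Hausdorff_space Z" "continuous_map (beta S) Z g"
    and "\<And>s. s \<in> S \<Longrightarrow> g (principal S s) = f s"
  shows "beta_extension S Z f = restrict g (topspace (beta S))"
  unfolding beta_extension_def
proof (rule the_equality)
  have "continuous_map (beta S) Z (restrict g (topspace (beta S)))"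
    using assms(2) by (rule continuous_map_eq) simp
  then show "restrict g (topspace (beta S)) \<in> extensional (topspace (beta S)) \<and>
    continuous_map (beta S) Z (restrict g (topspace (beta S))) \<and>
    (\<forall>s\<in>S. restrict g (topspace (beta S)) (principal S s) = f s)"
    using assms(3) by (simp add: topspace_beta principal_ultrafilter)
next
  fix h assume h: "h \<in> extensional (topspace (beta S)) \<and> continuous_map (beta S) Z h \<and>
    (\<forall>s\<in>S. h (principal S s) = f s)"
  have "h \<nu> = g \<nu>" if "\<nu> \<in> topspace (beta S)" for \<nu>
    by (rule forall_in_closure_of_eq[OF _ assms(1), of \<nu> "beta S" "principal S ` S"])
      (use h assms that principal_dense in auto)
  then show "h = restrict g (topspace (beta S))"
    using h by (auto simp: extensional_def restrict_def fun_eq_iff)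
qed

section \<open>Pushforward of ultrafilters and its fibres\<close>

text \<open>Preimages commute with the Boolean operations. That \<open>f\<close> maps into
  \<open>T\<close> makes the preimage of \<open>T\<close> all of \<open>S\<close> and preimages of
  complements complements.\<close>

lemma beta_map_ultrafilter:
  assumes f: "f ` S \<subseteq> T" and \<mu>: "\<mu> \<in> ultrafilters S"
  shows "beta_map S T f \<mu> \<in> ultrafilters T"
proof -
  have "{s \<in> S. f s \<in> T} = S" using f by auto
  moreover have "{s \<in> S. f s \<in> K \<inter> L} = {s \<in> S. f s \<in> K} \<inter> {s \<in> S. f s \<in> L}" for K L
    by auto
  moreover have "{s \<in> S. f s \<in> T - L} = S - {s \<in> S. f s \<in> L}" for L
    using f by auto
  moreover have "{s \<in> S. f s \<in> L} \<in> \<mu>" if "{s \<in> S. f s \<in> K} \<in> \<mu>" "K \<subseteq> L" for K L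
    using that by (intro ultrafilter_upward[OF \<mu> that(1)]) auto
  moreover have "{} \<notin> \<mu>" using \<mu> by (rule ultrafilter_empty)
  ultimately show ?thesis
    using ultrafilter_space[OF \<mu>] ultrafilter_Int[OF \<mu>] ultrafilter_Diff_iff[OF \<mu>]
    unfolding beta_map_def ultrafilters_def[of T] by auto
qed

lemma beta_map_principal: "s \<in> S \<Longrightarrow> f s \<in> T \<Longrightarrow> beta_map S T f (principal S s) = principal T (f s)"
  by (auto simp: beta_map_def principal_def)

lemma continuous_map_beta_map:
  assumes "f ` S \<subseteq> T"
  shows "continuous_map (beta S) (beta T) (beta_map S T f)"
  unfolding beta_def[of T]
proof (rule continuous_on_generated_topo)
  fix U assume "U \<in> hat T ` Pow T"
  then obtain L where L: "L \<subseteq> T" "U = hat T L" by blast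
  have "beta_map S T f -` hat T L \<inter> topspace (beta S) = hat S {s \<in> S. f s \<in> L}"
    using beta_map_ultrafilter[OF assms] L(1) by (auto simp: hat_def beta_map_def topspace_beta)
  then show "openin (beta S) (beta_map S T f -` U \<inter> topspace (beta S))"
    using openin_beta_hat[of "{s \<in> S. f s \<in> L}" S] L by auto
next
  show "beta_map S T f ` topspace (beta S) \<subseteq> \<Union> (hat T ` Pow T)"
    using beta_map_ultrafilter[OF assms] ultrafilter_space
    by (fastforce simp: hat_def topspace_beta)
qed

text \<open>Replaces a quantifier over the ultrafilters of a fibre by a single membership. The
  witness comes from the ultrafilter extension theorem.\<close>

lemma beta_map_fibre_iff:
  assumes f: "f ` S \<subseteq> T" and W: "W \<subseteq> S" and \<mu>: "\<mu> \<in> ultrafilters T"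
  shows "(\<exists>\<nu>\<in>ultrafilters S. beta_map S T f \<nu> = \<mu> \<and> W \<in> \<nu>) \<longleftrightarrow> f ` W \<in> \<mu>"
proof
  assume "\<exists>\<nu>\<in>ultrafilters S. beta_map S T f \<nu> = \<mu> \<and> W \<in> \<nu>"
  then obtain \<nu> where \<nu>: "\<nu> \<in> ultrafilters S" "beta_map S T f \<nu> = \<mu>" "W \<in> \<nu>" by blast
  have "{s \<in> S. f s \<in> f ` W} \<in> \<nu>"
    using W by (intro ultrafilter_upward[OF \<nu>(1,3)]) auto
  then show "f ` W \<in> \<mu>" using \<nu>(2) f W by (auto simp: beta_map_def)
next
  assume fW: "f ` W \<in> \<mu>"
  \<comment> \<open>These sets force both requirements: they put each member of \<mu> into the
    pushforward, and the image of \<open>W\<close>, taken as \<open>L\<close>, yields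
    \<open>W\<close> itself.\<close>
  let ?F = "(\<lambda>L. {s \<in> W. f s \<in> L}) ` \<mu>"
  have fip: "finite_intersection_property S ?F"
    unfolding finite_intersection_property_def
  proof (intro allI impI)
    fix H assume "finite H \<and> H \<subseteq> ?F"
    then obtain \<L> where \<L>: "finite \<L>" "\<L> \<subseteq> \<mu>" "H = (\<lambda>L. {s \<in> W. f s \<in> L}) ` \<L>"
      by (meson finite_subset_image)
    \<comment> \<open>Being in \<mu>, this set is non-empty; a point of \<open>W\<close> over it is
      common to all members of \<open>H\<close>.\<close>
    have "f ` W \<inter> \<Inter>\<L> \<in> \<mu>" using \<L>(1,2)
    proof (induction \<L> rule: finite_induct)
      case (insert L \<L>)
      then have "L \<inter> (f ` W \<inter> \<Inter>\<L>) \<in> \<mu>" using ultrafilter_Int[OF \<mu>] by blast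
      moreover have "L \<inter> (f ` W \<inter> \<Inter>\<L>) = f ` W \<inter> \<Inter>(insert L \<L>)" by blast
      ultimately show ?case by simp
    qed (use fW in simp)
    then have "f ` W \<inter> \<Inter>\<L> \<noteq> {}" using ultrafilter_empty[OF \<mu>] by metis
    then obtain w where "w \<in> W" "f w \<in> \<Inter>\<L>" by blast
    then have "w \<in> S \<inter> \<Inter>H" using W by (auto simp: \<L>(3))
    then show "S \<inter> \<Inter>H \<noteq> {}" by blast
  qed
  have "?F \<subseteq> Pow S" using W by blast
  from ultrafilter_extension[OF this fip]
  obtain \<nu> where \<nu>: "\<nu> \<in> ultrafilters S" "?F \<subseteq> \<nu>" by blast
  have sub: "\<mu> \<subseteq> beta_map S T f \<nu>"
  proof
    fix L assume L: "L \<in> \<mu>"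
    then have "{s \<in> W. f s \<in> L} \<in> \<nu>" using \<nu>(2) by blast
    then have "{s \<in> S. f s \<in> L} \<in> \<nu>"
      by (rule ultrafilter_upward[OF \<nu>(1)]) (use W in auto)
    then show "L \<in> beta_map S T f \<nu>"
      using ultrafilter_subset[OF \<mu> L] by (simp add: beta_map_def)
  qed
  have "beta_map S T f \<nu> = \<mu>"
    using \<mu> beta_map_ultrafilter[OF f \<nu>(1)] sub by (rule ultrafilter_maximal)
  moreover have "W \<in> \<nu>"
  proof -
    have "{s \<in> W. f s \<in> f ` W} \<in> \<nu>" using \<nu>(2) fW by blast
    moreover have "{s \<in> W. f s \<in> f ` W} = W" by blast
    ultimately show ?thesis by simp
  qed
  ultimately show "\<exists>\<nu>\<in>ultrafilters S. beta_map S T f \<nu> = \<mu> \<and> W \<in> \<nu>"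
    using \<nu>(1) by blast
qed

text \<open>The fibre is cut out by one clopen condition for each member of \<mu>. Together they say
  only that \<mu> is included in the pushforward, which is enough by maximality.\<close>

lemma closedin_beta_map_fibre:
  assumes f: "f ` S \<subseteq> T" and \<mu>: "\<mu> \<in> ultrafilters T"
  shows "closedin (beta S) {\<nu> \<in> ultrafilters S. beta_map S T f \<nu> = \<mu>}"
proof -
  have "{\<nu> \<in> ultrafilters S. beta_map S T f \<nu> = \<mu>} = (\<Inter>L\<in>\<mu>. hat S {s \<in> S. f s \<in> L})"
  proof (intro equalityI subsetI)
    fix \<nu> assume \<nu>: "\<nu> \<in> (\<Inter>L\<in>\<mu>. hat S {s \<in> S. f s \<in> L})"
    \<comment> \<open>\<open>T\<close> is a member of \<mu>, so the intersection runs over a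
      non-empty family and contains only ultrafilters.\<close>
    then have uf: "\<nu> \<in> ultrafilters S" using ultrafilter_space[OF \<mu>] by (auto simp: hat_def)
    have "\<mu> \<subseteq> beta_map S T f \<nu>"
      using \<nu> ultrafilter_subset[OF \<mu>] by (auto simp: hat_def beta_map_def)
    then have "beta_map S T f \<nu> = \<mu>"
      by (rule ultrafilter_maximal[OF \<mu> beta_map_ultrafilter[OF f uf]])
    then show "\<nu> \<in> {\<nu> \<in> ultrafilters S. beta_map S T f \<nu> = \<mu>}" using uf by blast
  qed (auto simp: hat_def beta_map_def)
  moreover have "closedin (beta S) (\<Inter>L\<in>\<mu>. hat S {s \<in> S. f s \<in> L})"
    using ultrafilter_space[OF \<mu>] by (intro closedin_Inter) (auto intro!: closedin_beta_hat)
  ultimately show ?thesis by simp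
qed

text \<open>The topology of \<A> is coarser than that of \<open>beta S\<close>, so the identity is
  continuous.\<close>

lemma continuous_map_hat_topology_imp_beta:
  assumes "S \<in> \<A>" "\<A> \<subseteq> Pow S" "continuous_map (hat_topology S \<A>) Z f"
  shows "continuous_map (beta S) Z f"
proof -
  have "continuous_map (beta S) (hat_topology S \<A>) id"
    unfolding hat_topology_def
  proof (rule continuous_on_generated_topo)
    fix U assume "U \<in> hat S ` \<A>"
    then have "openin (beta S) U" using assms(2) openin_beta_hat by blast
    then show "openin (beta S) (id -` U \<inter> topspace (beta S))" by (simp add: openin_Int)
  next
    show "id ` topspace (beta S) \<subseteq> \<Union>(hat S ` \<A>)"
      using UN_upper[OF assms(1), of "hat S"] by (simp add: hat_space topspace_beta)
  qed
  from continuous_map_compose[OF this assms(3)] show ?thesis by simp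
qed

section \<open>Clopen sets\<close>

lemma clopenin_preimage:
  assumes "continuous_map X Y f" "clopenin Y C"
  shows "clopenin X {x \<in> topspace X. f x \<in> C}"
  using assms openin_continuous_map_preimage[OF assms(1)] closedin_continuous_map_preimage[OF assms(1)]
  by (simp add: clopenin_def)

lemma clopenin_Times:
  "clopenin X C \<Longrightarrow> clopenin Y D \<Longrightarrow> clopenin (prod_topology X Y) (C \<times> D)"
  by (simp add: clopenin_def openin_prod_Times_iff closedin_prod_Times_iff)

lemma clopenin_Diff: "clopenin X C \<Longrightarrow> clopenin X (topspace X - C)"
  by (simp add: clopenin_def openin_diff closedin_diff)

text \<open>The complement of a diamond is the box of the complementary clopen set, hence
  open.\<close>

lemma clopenin_vietoris_diamond:
  assumes "clopenin Z V"
  shows "clopenin (vietoris Z) (vietoris_diamond Z V)"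
proof -
  have "openin (vietoris Z) (vietoris_diamond Z V)"
    unfolding vietoris_def by (rule topology_generated_by_Basis) (use assms in blast)
  moreover have "openin (vietoris Z) (vietoris_box Z (topspace Z - V))"
    unfolding vietoris_def
    by (rule topology_generated_by_Basis) (use clopenin_Diff[OF assms] in blast)
  moreover have "vietoris_box Z (topspace Z - V) = topspace (vietoris Z) - vietoris_diamond Z V"
    using closedin_subset by (fastforce simp: topspace_vietoris vietoris_box_def vietoris_diamond_def)
  moreover have "vietoris_diamond Z V \<subseteq> topspace (vietoris Z)"
    by (auto simp: topspace_vietoris vietoris_diamond_def)
  ultimately show ?thesis by (simp add: clopenin_def closedin_def)
qed

lemma boolean_space_clopen_neighbourhood:
  assumes "boolean_space X" "openin X U" "x \<in> U"
  obtains V where "clopenin X V" "x \<in> V" "V \<subseteq> U"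
proof -
  have "(arbitrary union_of clopenin X) U"
    using assms(1,2) by (simp add: boolean_space_def)
  then show ?thesis
    using that assms(3) unfolding arbitrary_union_of_alt by blast
qed

text \<open>The clopen rectangles inside \<open>V\<close> cover it, as both factors have clopen
  bases, and \<open>V\<close> is compact.\<close>

lemma clopenin_prod_finite_rectangles:
  assumes X: "boolean_space X" and Y: "boolean_space Y" and V: "clopenin (prod_topology X Y) V"
  obtains R where "finite R" "R \<subseteq> Collect (clopenin X) \<times> Collect (clopenin Y)"
    "V = (\<Union>(C, D)\<in>R. C \<times> D)"
proof -
  define \<R> where "\<R> = {(C, D). clopenin X C \<and> clopenin Y D \<and> C \<times> D \<subseteq> V}"
  have "compact_space (prod_topology X Y)"
    using X Y by (simp add: boolean_space_def compact_space_prod_topology)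
  then have "compactin (prod_topology X Y) V"
    using V by (simp add: clopenin_def closedin_compact_space)
  moreover have "\<forall>U\<in>(\<lambda>(C, D). C \<times> D) ` \<R>. openin (prod_topology X Y) U"
    by (auto simp: \<R>_def clopenin_def openin_prod_Times_iff)
  moreover have "V \<subseteq> \<Union>((\<lambda>(C, D). C \<times> D) ` \<R>)"
  proof
    fix p assume p: "p \<in> V"
    obtain x y where xy: "p = (x, y)" by fastforce
    have "openin (prod_topology X Y) V" using V by (simp add: clopenin_def)
    then obtain C' D' where CD': "openin X C'" "openin Y D'" "x \<in> C'" "y \<in> D'" "C' \<times> D' \<subseteq> V"
      using p xy unfolding openin_prod_topology_alt by metis
    obtain C where C: "clopenin X C" "x \<in> C" "C \<subseteq> C'"
      by (rule boolean_space_clopen_neighbourhood[OF X CD'(1,3)])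
    obtain D where D: "clopenin Y D" "y \<in> D" "D \<subseteq> D'"
      by (rule boolean_space_clopen_neighbourhood[OF Y CD'(2,4)])
    have "(C, D) \<in> \<R>" using C D CD'(5) by (auto simp: \<R>_def)
    then show "p \<in> \<Union>((\<lambda>(C, D). C \<times> D) ` \<R>)" using C D xy by force
  qed
  ultimately obtain \<F> where \<F>: "finite \<F>" "\<F> \<subseteq> (\<lambda>(C, D). C \<times> D) ` \<R>" "V \<subseteq> \<Union>\<F>"
    unfolding compactin_def by metis
  then obtain R where R: "finite R" "R \<subseteq> \<R>" "\<F> = (\<lambda>(C, D). C \<times> D) ` R"
    by (meson finite_subset_image)
  have "V = (\<Union>(C, D)\<in>R. C \<times> D)"
    using \<F>(3) R(2,3) by (auto simp: \<R>_def)
  moreover have "R \<subseteq> Collect (clopenin X) \<times> Collect (clopenin Y)"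
    using R(2) by (auto simp: \<R>_def)
  ultimately show ?thesis using that R(1) by blast
qed

section \<open>Recognition\<close>

text \<open>The closure conditions pass to intersections. \<open>G\<close> must consist of subsets
  of \<open>S\<close>: otherwise no algebra contains it and the hull, an empty intersection, is
  \<open>UNIV\<close>.\<close>

lemma algebra_hull:
  assumes "G \<subseteq> Pow S"
  shows "algebra S (algebra S hull G)"
proof -
  have "algebra S hull G \<subseteq> Pow S" using assms algebra_Pow_space by (rule hull_minimal)
  moreover have mem: "K \<in> algebra S hull G \<longleftrightarrow> (\<forall>\<A>. algebra S \<A> \<and> G \<subseteq> \<A> \<longrightarrow> K \<in> \<A>)" for K
    by (simp add: hull_def)
  ultimately show ?thesis
    unfolding algebra_iff_Un[of S "algebra S hull G"] Ball_def mem by (simp add: algebra_iff_Un)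
qed

lemma preimage_clopenin_eq_hat:
  assumes "continuous_map (beta S) Z f" "clopenin Z C"
  shows "{\<mu> \<in> topspace (beta S). f \<mu> \<in> C} = hat S {s \<in> S. f (principal S s) \<in> C}"
  using continuous_map_beta_clopenin_iff[OF assms] by (auto simp: topspace_beta hat_def)

text \<open>The preimage of a clopen set is the \<open>hat\<close> of its trace on words, and
  \<open>hat\<close> is injective, so recognition can be checked on words.\<close>

lemma recognised_by_iff:
  assumes "continuous_map (beta (lists A)) Z f"
  shows "recognised_by A Z f L \<longleftrightarrow>
    (\<exists>C. clopenin Z C \<and> L = {u \<in> lists A. f (principal (lists A) u) \<in> C})" (is "?l \<longleftrightarrow> ?r")
proof
  assume ?l
  then obtain C where L: "L \<subseteq> lists A" and C: "clopenin Z C"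
    and "hat (lists A) L = {\<mu> \<in> topspace (beta (lists A)). f \<mu> \<in> C}"
    unfolding recognised_by_def by blast
  then have "hat (lists A) L = hat (lists A) {u \<in> lists A. f (principal (lists A) u) \<in> C}"
    using preimage_clopenin_eq_hat[OF assms C] by simp
  then have "L = {u \<in> lists A. f (principal (lists A) u) \<in> C}"
    using hat_eq_iff[OF L] by (metis (no_types, lifting) mem_Collect_eq subsetI)
  with C show ?r by blast
next
  assume ?r
  then show ?l
    unfolding recognised_by_def using preimage_clopenin_eq_hat[OF assms] by fastforce
qed

lemma algebra_recognised_by:
  assumes f: "continuous_map (beta (lists A)) Z f"
  shows "algebra (lists A) {L. recognised_by A Z f L}"
  unfolding algebra_iff_Un
proof (intro conjI ballI)
  show "{L. recognised_by A Z f L} \<subseteq> Pow (lists A)" by (auto simp: recognised_by_def)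
  show "{} \<in> {L. recognised_by A Z f L}"
    unfolding mem_Collect_eq recognised_by_iff[OF f]
    by (rule exI[of _ "{}"]) (simp add: clopenin_def)
next
  fix L assume "L \<in> {L. recognised_by A Z f L}"
  then obtain C where C: "clopenin Z C" and L: "L = {u \<in> lists A. f (principal (lists A) u) \<in> C}"
    using recognised_by_iff[OF f] by blast
  \<comment> \<open>Only because the values lie in the space does the complement of \<open>C\<close>
    pull back to the complement of \<open>L\<close>.\<close>
  have "f (principal (lists A) u) \<in> topspace Z" if "u \<in> lists A" for u
    using f principal_ultrafilter[OF that] by (auto simp: continuous_map_def topspace_beta)
  then have "lists A - L = {u \<in> lists A. f (principal (lists A) u) \<in> topspace Z - C}"
    unfolding L by blast
  then show "lists A - L \<in> {L. recognised_by A Z f L}"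
    using clopenin_Diff[OF C] recognised_by_iff[OF f] by blast
next
  fix K L assume "K \<in> {L. recognised_by A Z f L}" "L \<in> {L. recognised_by A Z f L}"
  then obtain C D where C: "clopenin Z C" and K: "K = {u \<in> lists A. f (principal (lists A) u) \<in> C}"
    and D: "clopenin Z D" and L: "L = {u \<in> lists A. f (principal (lists A) u) \<in> D}"
    unfolding mem_Collect_eq recognised_by_iff[OF f] by blast
  have "clopenin Z (C \<union> D)" using C D by (simp add: clopenin_def openin_Un closedin_Un)
  moreover have "K \<union> L = {u \<in> lists A. f (principal (lists A) u) \<in> C \<union> D}"
    unfolding K L by blast
  ultimately show "K \<union> L \<in> {L. recognised_by A Z f L}"
    unfolding mem_Collect_eq recognised_by_iff[OF f] by blast
qed

section \<open>Reutenauer's theorem\<close>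

locale recognising_pair =
  fixes A :: "'a set" and X :: "'x topology" and Y :: "'y topology"
    and \<phi>\<^sub>1 :: "'a list set set \<Rightarrow> 'x" and \<phi>\<^sub>2 :: "'a list set set \<Rightarrow> 'y"
  assumes boolean\<^sub>1: "boolean_space X" and boolean\<^sub>2: "boolean_space Y"
    and continuous\<^sub>1: "continuous_map (beta (lists A)) X \<phi>\<^sub>1"
    and continuous\<^sub>2: "continuous_map (beta (lists A)) Y \<phi>\<^sub>2"
begin

abbreviation "\<W> \<equiv> lists A"
abbreviation "\<L> \<equiv> reutenauer_algebra A X Y \<phi>\<^sub>1 \<phi>\<^sub>2"
abbreviation "\<zeta> \<equiv> zeta A X Y \<phi>\<^sub>1 \<phi>\<^sub>2"
abbreviation "\<Phi> \<equiv> reutenauer_map A X Y \<phi>\<^sub>1 \<phi>\<^sub>2"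

section \<open>Factorisations of words and the Vietoris component\<close>

text \<open>Existential quantification over an occurrence of \<open>a\<close>: for clopen
  \<open>V\<close> and \<open>a\<close> in \<open>A\<close>, these are the words whose principal
  ultrafilter \<open>\<zeta> a\<close> sends to a set meeting \<open>V\<close>.\<close>

definition factorisations :: "'a \<Rightarrow> ('x \<times> 'y) set \<Rightarrow> 'a list set" where
  "factorisations a V = {u @ [a] @ v |u v. u \<in> \<W> \<and> v \<in> \<W> \<and>
     (\<phi>\<^sub>1 (principal \<W> u), \<phi>\<^sub>2 (principal \<W> v)) \<in> V}"

lemma unmark_marked_words: "a \<in> A \<Longrightarrow> unmark ` marked_words A a \<subseteq> \<W>"
  by (auto simp: unmark_def marked_words_def)

lemma factorisations_subset: "a \<in> A \<Longrightarrow> factorisations a V \<subseteq> \<W>"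
  by (auto simp: factorisations_def)

lemma Hausdorff_prod: "Hausdorff_space (prod_topology X Y)"
  using boolean\<^sub>1 boolean\<^sub>2 by (simp add: boolean_space_def Hausdorff_space_prod_topology)

lemma continuous_map_marked_pair:
  "continuous_map (beta (marked_words A a)) (prod_topology X Y)
     (\<lambda>\<nu>. (\<phi>\<^sub>1 (beta_map (marked_words A a) \<W> fst \<nu>),
          \<phi>\<^sub>2 (beta_map (marked_words A a) \<W> (snd \<circ> snd) \<nu>)))"
proof -
  have 1: "fst ` marked_words A a \<subseteq> \<W>" and 2: "(snd \<circ> snd) ` marked_words A a \<subseteq> \<W>"
    by (auto simp: marked_words_def)
  show ?thesis
    using continuous_map_compose[OF continuous_map_beta_map[OF 1] continuous\<^sub>1]
      continuous_map_compose[OF continuous_map_beta_map[OF 2] continuous\<^sub>2]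
    by (intro continuous_map_pairedI) (simp_all only: comp_def)
qed

text \<open>Composing with the extended projections gives the extension explicitly, so its existence
  needs no general extension theorem.\<close>

lemma pair_extension_eq:
  "pair_extension A X Y \<phi>\<^sub>1 \<phi>\<^sub>2 a = restrict
     (\<lambda>\<nu>. (\<phi>\<^sub>1 (beta_map (marked_words A a) \<W> fst \<nu>),
          \<phi>\<^sub>2 (beta_map (marked_words A a) \<W> (snd \<circ> snd) \<nu>)))
     (topspace (beta (marked_words A a)))"
  unfolding pair_extension_def
proof (rule beta_extension_eq[OF Hausdorff_prod continuous_map_marked_pair])
  fix s assume s: "s \<in> marked_words A a"
  then have "fst s \<in> \<W>" "(snd \<circ> snd) s \<in> \<W>"
    by (auto simp: marked_words_def)
  then show "(\<phi>\<^sub>1 (beta_map (marked_words A a) \<W> fst (principal (marked_words A a) s)),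
      \<phi>\<^sub>2 (beta_map (marked_words A a) \<W> (snd \<circ> snd) (principal (marked_words A a) s))) =
    (case s of (u, _, v) \<Rightarrow> (\<phi>\<^sub>1 (principal \<W> u), \<phi>\<^sub>2 (principal \<W> v)))"
    using beta_map_principal[OF s, of fst \<W>] beta_map_principal[OF s, of "snd \<circ> snd" \<W>]
    by (simp split: prod.split)
qed

lemma continuous_map_pair_extension:
  "continuous_map (beta (marked_words A a)) (prod_topology X Y) (pair_extension A X Y \<phi>\<^sub>1 \<phi>\<^sub>2 a)"
  by (rule continuous_map_eq[OF continuous_map_marked_pair]) (simp add: pair_extension_eq)

lemma pair_extension_principal:
  assumes "u \<in> \<W>" "v \<in> \<W>"
  shows "pair_extension A X Y \<phi>\<^sub>1 \<phi>\<^sub>2 a (principal (marked_words A a) (u, a, v)) =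
    (\<phi>\<^sub>1 (principal \<W> u), \<phi>\<^sub>2 (principal \<W> v))"
proof -
  have "(u, a, v) \<in> marked_words A a" using assms by (simp add: marked_words_def)
  then show ?thesis
    using assms beta_map_principal[of "(u, a, v)" "marked_words A a" fst \<W>]
      beta_map_principal[of "(u, a, v)" "marked_words A a" "snd \<circ> snd" \<W>]
    by (simp add: pair_extension_eq topspace_beta principal_ultrafilter)
qed

text \<open>As \<open>V\<close> is clopen, an ultrafilter on marked words has its value in
  \<open>V\<close> iff it contains the set of marked words with value in \<open>V\<close>. The fibre
  criterion then projects that set along \<open>unmark\<close>.\<close>

lemma zeta_meets_clopenin_iff:
  assumes a: "a \<in> A" and \<mu>: "\<mu> \<in> ultrafilters \<W>" and V: "clopenin (prod_topology X Y) V"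
  shows "\<zeta> a \<mu> \<inter> V \<noteq> {} \<longleftrightarrow> factorisations a V \<in> \<mu>"
proof -
  let ?S = "marked_words A a" and ?p = "pair_extension A X Y \<phi>\<^sub>1 \<phi>\<^sub>2 a"
  let ?W = "{s \<in> ?S. ?p (principal ?S s) \<in> V}"
  have clopen: "?p \<nu> \<in> V \<longleftrightarrow> ?W \<in> \<nu>" if "\<nu> \<in> ultrafilters ?S" for \<nu>
    by (rule continuous_map_beta_clopenin_iff[OF continuous_map_pair_extension V that])
  have "\<zeta> a \<mu> \<inter> V \<noteq> {} \<longleftrightarrow>
      (\<exists>\<nu>\<in>ultrafilters ?S. beta_map ?S \<W> unmark \<nu> = \<mu> \<and> ?p \<nu> \<in> V)"
    unfolding zeta_def topspace_beta by blast
  also have "\<dots> \<longleftrightarrow> (\<exists>\<nu>\<in>ultrafilters ?S. beta_map ?S \<W> unmark \<nu> = \<mu> \<and> ?W \<in> \<nu>)"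
    by (rule bex_cong) (simp_all only: clopen)
  also have "\<dots> \<longleftrightarrow> unmark ` ?W \<in> \<mu>"
    by (rule beta_map_fibre_iff[OF unmark_marked_words[OF a] _ \<mu>]) blast
  also have "unmark ` ?W = factorisations a V"
  proof -
    have W: "?W = {(u, a, v) |u v. u \<in> \<W> \<and> v \<in> \<W> \<and>
        (\<phi>\<^sub>1 (principal \<W> u), \<phi>\<^sub>2 (principal \<W> v)) \<in> V}" (is "_ = ?W'")
    proof (intro equalityI subsetI)
      fix s assume "s \<in> ?W"
      then obtain u v where "s = (u, a, v)" "u \<in> \<W>" "v \<in> \<W>" "?p (principal ?S s) \<in> V"
        unfolding marked_words_def by blast
      then show "s \<in> ?W'" using pair_extension_principal[of u v a] by simp
    next
      fix s assume "s \<in> ?W'"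
      then obtain u v where s: "s = (u, a, v)" "u \<in> \<W>" "v \<in> \<W>"
        "(\<phi>\<^sub>1 (principal \<W> u), \<phi>\<^sub>2 (principal \<W> v)) \<in> V" by blast
      then have "s \<in> ?S" by (simp add: marked_words_def)
      then show "s \<in> ?W" using s pair_extension_principal[of u v a] by simp
    qed
    show ?thesis unfolding W factorisations_def unmark_def by (auto simp: image_def)
  qed
  finally show ?thesis .
qed

text \<open>The closed fibre is compact, so its continuous image is compact and closed in the
  Hausdorff product. Hence the values are points of the Vietoris space.\<close>

lemma closedin_zeta:
  assumes "a \<in> A" "\<mu> \<in> ultrafilters \<W>"
  shows "closedin (prod_topology X Y) (\<zeta> a \<mu>)"
proof -
  let ?S = "marked_words A a"
  have "closedin (beta ?S) {\<nu> \<in> topspace (beta ?S). beta_map ?S \<W> unmark \<nu> = \<mu>}"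
    unfolding topspace_beta
    by (rule closedin_beta_map_fibre[OF unmark_marked_words[OF assms(1)] assms(2)])
  then have "compactin (beta ?S) {\<nu> \<in> topspace (beta ?S). beta_map ?S \<W> unmark \<nu> = \<mu>}"
    by (rule closedin_compact_space[OF compact_space_beta])
  then have "compactin (prod_topology X Y) (\<zeta> a \<mu>)"
    unfolding zeta_def by (rule image_compactin[OF _ continuous_map_pair_extension])
  then show ?thesis by (rule compactin_imp_closedin[OF Hausdorff_prod])
qed

section \<open>The generated algebra of languages\<close>

lemma marked_product_subset:
  assumes "L\<^sub>1 \<subseteq> \<W>" "a \<in> A" "L\<^sub>2 \<subseteq> \<W>"
  shows "marked_product L\<^sub>1 a L\<^sub>2 \<subseteq> \<W>"
proof
  fix w assume "w \<in> marked_product L\<^sub>1 a L\<^sub>2"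
  then obtain u v where "w = u @ [a] @ v" "u \<in> L\<^sub>1" "v \<in> L\<^sub>2"
    unfolding marked_product_def by blast
  moreover have "u \<in> \<W>" "v \<in> \<W>" using assms calculation by blast+
  ultimately show "w \<in> \<W>" using assms(2) by simp
qed

lemma algebra_reutenauer_algebra: "algebra \<W> \<L>"
  unfolding reutenauer_algebra_def
proof (rule algebra_hull, intro Un_least)
  show "{L\<^sub>1. recognised_by A X \<phi>\<^sub>1 L\<^sub>1} \<subseteq> Pow \<W>" "{L\<^sub>2. recognised_by A Y \<phi>\<^sub>2 L\<^sub>2} \<subseteq> Pow \<W>"
    by (auto simp only: recognised_by_def)
  show "{marked_product L\<^sub>1 a L\<^sub>2 |L\<^sub>1 a L\<^sub>2.
      recognised_by A X \<phi>\<^sub>1 L\<^sub>1 \<and> a \<in> A \<and> recognised_by A Y \<phi>\<^sub>2 L\<^sub>2} \<subseteq> Pow \<W>"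
  proof
    fix K assume "K \<in> {marked_product L\<^sub>1 a L\<^sub>2 |L\<^sub>1 a L\<^sub>2.
      recognised_by A X \<phi>\<^sub>1 L\<^sub>1 \<and> a \<in> A \<and> recognised_by A Y \<phi>\<^sub>2 L\<^sub>2}"
    then obtain L\<^sub>1 a L\<^sub>2 where rec: "recognised_by A X \<phi>\<^sub>1 L\<^sub>1" "a \<in> A" "recognised_by A Y \<phi>\<^sub>2 L\<^sub>2"
      and K: "K = marked_product L\<^sub>1 a L\<^sub>2" by (elim CollectE exE conjE)
    have "L\<^sub>1 \<subseteq> \<W>" "L\<^sub>2 \<subseteq> \<W>" using rec by (simp_all only: recognised_by_def)
    then show "K \<in> Pow \<W>" unfolding K using rec(2) by (intro PowI marked_product_subset)
  qed
qed

lemma recognised_in_reutenauer_algebra: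
  "recognised_by A X \<phi>\<^sub>1 L\<^sub>1 \<Longrightarrow> L\<^sub>1 \<in> \<L>"
  "recognised_by A Y \<phi>\<^sub>2 L\<^sub>2 \<Longrightarrow> L\<^sub>2 \<in> \<L>"
  "recognised_by A X \<phi>\<^sub>1 L\<^sub>1 \<Longrightarrow> a \<in> A \<Longrightarrow> recognised_by A Y \<phi>\<^sub>2 L\<^sub>2 \<Longrightarrow> marked_product L\<^sub>1 a L\<^sub>2 \<in> \<L>"
proof -
  show "L\<^sub>1 \<in> \<L>" if "recognised_by A X \<phi>\<^sub>1 L\<^sub>1"
    unfolding reutenauer_algebra_def using that by (intro hull_inc UnI1 CollectI)
  show "L\<^sub>2 \<in> \<L>" if "recognised_by A Y \<phi>\<^sub>2 L\<^sub>2"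
    unfolding reutenauer_algebra_def using that by (intro hull_inc UnI1[OF UnI2] CollectI)
  show "marked_product L\<^sub>1 a L\<^sub>2 \<in> \<L>"
    if "recognised_by A X \<phi>\<^sub>1 L\<^sub>1" "a \<in> A" "recognised_by A Y \<phi>\<^sub>2 L\<^sub>2"
    unfolding reutenauer_algebra_def
    by (rule hull_inc, rule UnI2, rule CollectI)
      (rule exI[of _ L\<^sub>1], rule exI[of _ a], rule exI[of _ L\<^sub>2], intro conjI refl that)
qed

lemma factorisations_Times:
  "factorisations a (C \<times> D) = marked_product {u \<in> \<W>. \<phi>\<^sub>1 (principal \<W> u) \<in> C} a
     {v \<in> \<W>. \<phi>\<^sub>2 (principal \<W> v) \<in> D}"
  by (auto simp: factorisations_def marked_product_def)

text \<open>\<open>factorisations a\<close> preserves unions, so splitting \<open>V\<close> into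
  finitely many clopen rectangles yields a finite union of marked products of recognised
  languages.\<close>

lemma factorisations_in_reutenauer_algebra:
  assumes "a \<in> A" "clopenin (prod_topology X Y) V"
  shows "factorisations a V \<in> \<L>"
proof -
  interpret algebra \<W> \<L> by (rule algebra_reutenauer_algebra)
  obtain R where R: "finite R" "R \<subseteq> Collect (clopenin X) \<times> Collect (clopenin Y)"
    and V: "V = (\<Union>(C, D)\<in>R. C \<times> D)"
    by (rule clopenin_prod_finite_rectangles[OF boolean\<^sub>1 boolean\<^sub>2 assms(2)])
  have "factorisations a (fst r \<times> snd r) \<in> \<L>" if "r \<in> R" for r
  proof -
    have "clopenin X (fst r)" "clopenin Y (snd r)" using R(2) that by auto
    then have "recognised_by A X \<phi>\<^sub>1 {u \<in> \<W>. \<phi>\<^sub>1 (principal \<W> u) \<in> fst r}"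
      "recognised_by A Y \<phi>\<^sub>2 {v \<in> \<W>. \<phi>\<^sub>2 (principal \<W> v) \<in> snd r}"
      unfolding recognised_by_iff[OF continuous\<^sub>1] recognised_by_iff[OF continuous\<^sub>2] by blast+
    then show ?thesis
      unfolding factorisations_Times using assms(1) by (intro recognised_in_reutenauer_algebra(3))
  qed
  then have "(\<Union>r\<in>R. factorisations a (fst r \<times> snd r)) \<in> \<L>"
    using R(1) by (intro finite_UN) auto
  moreover have "factorisations a V = (\<Union>r\<in>R. factorisations a (fst r \<times> snd r))"
    unfolding V factorisations_def by (auto simp: case_prod_unfold; blast)
  ultimately show ?thesis by simp
qed

section \<open>Continuity for the topology of the generated algebra\<close>

lemma topspace_algebra_topology: "topspace (hat_topology \<W> \<L>) = ultrafilters \<W>"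
proof -
  interpret algebra \<W> \<L> by (rule algebra_reutenauer_algebra)
  show ?thesis by (rule topspace_hat_topology[OF top])
qed

text \<open>The clopen sets form a base of \<open>Z\<close>, and each pulls back to the
  \<open>hat\<close> of its trace on words, a base set by the last assumption.\<close>

lemma continuous_map_algebra_topology:
  assumes "boolean_space Z" "continuous_map (beta \<W>) Z f"
    and "\<And>C. clopenin Z C \<Longrightarrow> {u \<in> \<W>. f (principal \<W> u) \<in> C} \<in> \<L>"
  shows "continuous_map (hat_topology \<W> \<L>) Z f"
proof (rule continuous_map_into_topology_base)
  show "openin Z = arbitrary union_of (clopenin Z)"
    using assms(1) by (simp add: boolean_space_def)
  show "f \<mu> \<in> topspace Z" if "\<mu> \<in> topspace (hat_topology \<W> \<L>)" for \<mu>
    using assms(2) that by (auto simp: topspace_algebra_topology continuous_map_def topspace_beta)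
  show "openin (hat_topology \<W> \<L>) {\<mu> \<in> topspace (hat_topology \<W> \<L>). f \<mu> \<in> C}"
    if "clopenin Z C" for C
    using preimage_clopenin_eq_hat[OF assms(2) that] openin_hat_topology[OF assms(3)[OF that]]
    by (simp add: topspace_algebra_topology topspace_beta)
qed

text \<open>Generating open sets suffice: a diamond pulls back to the \<open>hat\<close> of a
  language of factorisations, a box to the complement of one for the complementary clopen
  set.\<close>

lemma continuous_map_zeta:
  assumes a: "a \<in> A"
  shows "continuous_map (hat_topology \<W> \<L>) (vietoris (prod_topology X Y)) (\<zeta> a)"
proof -
  interpret algebra \<W> \<L> by (rule algebra_reutenauer_algebra)
  let ?Z = "prod_topology X Y"
  have diamond: "\<zeta> a -` vietoris_diamond ?Z V \<inter> ultrafilters \<W> = hat \<W> (factorisations a V)"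
    if "clopenin ?Z V" for V
    using zeta_meets_clopenin_iff[OF a _ that] closedin_zeta[OF a]
    by (auto simp: vietoris_diamond_def hat_def)
  have box: "\<zeta> a -` vietoris_box ?Z V \<inter> ultrafilters \<W> =
      hat \<W> (\<W> - factorisations a (topspace ?Z - V))" if "clopenin ?Z V" for V
  proof -
    have "\<zeta> a \<mu> \<in> vietoris_box ?Z V \<longleftrightarrow> factorisations a (topspace ?Z - V) \<notin> \<mu>"
      if \<mu>: "\<mu> \<in> ultrafilters \<W>" for \<mu>
    proof -
      \<comment> \<open>\<open>\<zeta> a \<mu>\<close> is a subset of the space, so lying in
        \<open>V\<close> means missing the complement of \<open>V\<close>.\<close>
      have "\<zeta> a \<mu> \<in> vietoris_box ?Z V \<longleftrightarrow> \<zeta> a \<mu> \<inter> (topspace ?Z - V) = {}"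
        using closedin_zeta[OF a \<mu>] closedin_subset[OF closedin_zeta[OF a \<mu>]]
        unfolding vietoris_box_def by blast
      then show ?thesis
        using zeta_meets_clopenin_iff[OF a \<mu> clopenin_Diff[OF \<open>clopenin ?Z V\<close>]] by blast
    qed
    then show ?thesis
      unfolding hat_Diff[OF factorisations_subset[OF a]] by (auto simp: hat_def)
  qed
  show ?thesis
    unfolding vietoris_def
  proof (rule continuous_on_generated_topo)
    fix U assume "U \<in> vietoris_box ?Z ` {V. clopenin ?Z V} \<union> vietoris_diamond ?Z ` {V. clopenin ?Z V}"
    then consider V where "clopenin ?Z V" "U = vietoris_box ?Z V"
      | V where "clopenin ?Z V" "U = vietoris_diamond ?Z V" by blast
    then show "openin (hat_topology \<W> \<L>) (\<zeta> a -` U \<inter> topspace (hat_topology \<W> \<L>))"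
    proof cases
      case (1 V)
      have "\<W> - factorisations a (topspace ?Z - V) \<in> \<L>"
        by (rule compl_sets[OF factorisations_in_reutenauer_algebra[OF a clopenin_Diff[OF 1(1)]]])
      then show ?thesis
        using 1 by (simp only: topspace_algebra_topology box openin_hat_topology)
    next
      case (2 V)
      then show ?thesis
        using factorisations_in_reutenauer_algebra[OF a 2(1)]
        by (simp only: topspace_algebra_topology diamond openin_hat_topology)
    qed
  next
    have "\<zeta> a \<mu> \<in> topspace (vietoris ?Z)" if "\<mu> \<in> topspace (hat_topology \<W> \<L>)" for \<mu>
      using that closedin_zeta[OF a] by (simp add: topspace_algebra_topology topspace_vietoris)
    then show "\<zeta> a ` topspace (hat_topology \<W> \<L>) \<subseteq>
        \<Union>(vietoris_box ?Z ` {V. clopenin ?Z V} \<union> vietoris_diamond ?Z ` {V. clopenin ?Z V})"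
      unfolding vietoris_def topology_generated_by_topspace by blast
  qed
qed

text \<open>Checked componentwise; for \<open>\<phi>\<^sub>1\<close> and
  \<open>\<phi>\<^sub>2\<close> the traces of clopen sets are themselves generators of the
  algebra.\<close>

lemma continuous_map_reutenauer_map:
  "continuous_map (hat_topology \<W> \<L>) (reutenauer_space A X Y) \<Phi>"
proof -
  have rec\<^sub>1: "recognised_by A X \<phi>\<^sub>1 {u \<in> \<W>. \<phi>\<^sub>1 (principal \<W> u) \<in> C}" if "clopenin X C" for C
    unfolding recognised_by_iff[OF continuous\<^sub>1] using that by blast
  have rec\<^sub>2: "recognised_by A Y \<phi>\<^sub>2 {u \<in> \<W>. \<phi>\<^sub>2 (principal \<W> u) \<in> C}" if "clopenin Y C" for C
    unfolding recognised_by_iff[OF continuous\<^sub>2] using that by blast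
  have 1: "continuous_map (hat_topology \<W> \<L>) X \<phi>\<^sub>1"
    by (rule continuous_map_algebra_topology[OF boolean\<^sub>1 continuous\<^sub>1
          recognised_in_reutenauer_algebra(1)[OF rec\<^sub>1]])
  have 2: "continuous_map (hat_topology \<W> \<L>) Y \<phi>\<^sub>2"
    by (rule continuous_map_algebra_topology[OF boolean\<^sub>2 continuous\<^sub>2
          recognised_in_reutenauer_algebra(2)[OF rec\<^sub>2]])
  have 3: "continuous_map (hat_topology \<W> \<L>)
      (product_topology (\<lambda>_. vietoris (prod_topology X Y)) A) (\<lambda>\<mu>. \<lambda>a\<in>A. \<zeta> a \<mu>)"
    unfolding continuous_map_componentwise using continuous_map_zeta by (simp add: image_subset_iff)
  show ?thesis
    unfolding reutenauer_space_def reutenauer_map_def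
    by (rule continuous_map_pairedI[OF 3 continuous_map_pairedI[OF 1 2]])
qed

lemma continuous_map_beta_reutenauer_map:
  "continuous_map (beta \<W>) (reutenauer_space A X Y) \<Phi>"
proof -
  interpret algebra \<W> \<L> by (rule algebra_reutenauer_algebra)
  show ?thesis
    by (rule continuous_map_hat_topology_imp_beta[OF top space_closed continuous_map_reutenauer_map])
qed

section \<open>The two directions of the equivalence\<close>

text \<open>Continuity for the coarser topology is decisive: it makes \<open>hat \<W> L\<close>
  clopen there, hence the \<open>hat\<close> of a member of the algebra, which is \<open>L\<close>
  by injectivity.\<close>

lemma recognised_imp_in_reutenauer_algebra:
  assumes "recognised_by A (reutenauer_space A X Y) \<Phi> L"
  shows "L \<in> \<L>"
proof -
  interpret algebra \<W> \<L> by (rule algebra_reutenauer_algebra)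
  obtain C where L: "L \<subseteq> \<W>" and C: "clopenin (reutenauer_space A X Y) C"
    and hat: "hat \<W> L = {\<mu> \<in> topspace (beta \<W>). \<Phi> \<mu> \<in> C}"
    using assms unfolding recognised_by_def by blast
  have "clopenin (hat_topology \<W> \<L>) (hat \<W> L)"
    using clopenin_preimage[OF continuous_map_reutenauer_map C]
    by (simp add: hat topspace_algebra_topology topspace_beta)
  then have "hat \<W> L \<in> hat \<W> ` \<L>"
    by (rule clopenin_hat_topology[OF algebra_reutenauer_algebra])
  then obtain K where K: "hat \<W> L = hat \<W> K" "K \<in> \<L>" by (rule imageE)
  then have "L = K" using hat_eq_iff[OF L sets_into_space[OF K(2)]] by simp
  then show ?thesis using K(2) by simp
qed

text \<open>Serves to recognise a language through a single coordinate \<open>f\<close> of the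
  codomain: the preimage of \<open>C\<close> under \<open>f\<close> is the clopen set.\<close>

lemma recognised_by_reutenauer_mapI:
  assumes "continuous_map (reutenauer_space A X Y) Z f" "clopenin Z C"
    and "\<And>u. u \<in> \<W> \<Longrightarrow> u \<in> L \<longleftrightarrow> f (\<Phi> (principal \<W> u)) \<in> C" "L \<subseteq> \<W>"
  shows "recognised_by A (reutenauer_space A X Y) \<Phi> L"
proof -
  let ?C = "{z \<in> topspace (reutenauer_space A X Y). f z \<in> C}"
  have "\<Phi> (principal \<W> u) \<in> topspace (reutenauer_space A X Y)" if "u \<in> \<W>" for u
    using continuous_map_beta_reutenauer_map principal_ultrafilter[OF that]
    by (auto simp: continuous_map_def topspace_beta)
  then have "L = {u \<in> \<W>. \<Phi> (principal \<W> u) \<in> ?C}" using assms(3,4) by blast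
  then show ?thesis
    unfolding recognised_by_iff[OF continuous_map_beta_reutenauer_map]
    using clopenin_preimage[OF assms(1,2)] by blast
qed

text \<open>The recognised languages form an algebra, so generators suffice. Projections handle the
  first two kinds; a marked product is seen by coordinate \<open>a\<close> through the diamond of a
  clopen rectangle.\<close>

lemma in_reutenauer_algebra_imp_recognised:
  assumes "L \<in> \<L>"
  shows "recognised_by A (reutenauer_space A X Y) \<Phi> L"
proof -
  have proj: "continuous_map (reutenauer_space A X Y) X (\<lambda>z. fst (snd z))"
    "continuous_map (reutenauer_space A X Y) Y (\<lambda>z. snd (snd z))"
    unfolding reutenauer_space_def
    by (intro continuous_map_compose[OF continuous_map_snd continuous_map_fst, unfolded comp_def]
        continuous_map_compose[OF continuous_map_snd continuous_map_snd, unfolded comp_def])+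
  have component: "continuous_map (reutenauer_space A X Y) (vietoris (prod_topology X Y)) (\<lambda>z. fst z a)"
    if "a \<in> A" for a
    unfolding reutenauer_space_def
    using continuous_map_compose[OF continuous_map_fst continuous_map_product_projection[OF that]]
    by (simp add: comp_def)
  have 1: "recognised_by A (reutenauer_space A X Y) \<Phi> L\<^sub>1" if rec: "recognised_by A X \<phi>\<^sub>1 L\<^sub>1" for L\<^sub>1
  proof -
    obtain C where C: "clopenin X C" "L\<^sub>1 = {u \<in> \<W>. \<phi>\<^sub>1 (principal \<W> u) \<in> C}"
      using rec recognised_by_iff[OF continuous\<^sub>1] by blast
    show ?thesis
      by (rule recognised_by_reutenauer_mapI[OF proj(1) C(1)]) (auto simp: C(2) reutenauer_map_def)
  qed
  have 2: "recognised_by A (reutenauer_space A X Y) \<Phi> L\<^sub>2" if rec: "recognised_by A Y \<phi>\<^sub>2 L\<^sub>2" for L\<^sub>2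
  proof -
    obtain C where C: "clopenin Y C" "L\<^sub>2 = {u \<in> \<W>. \<phi>\<^sub>2 (principal \<W> u) \<in> C}"
      using rec recognised_by_iff[OF continuous\<^sub>2] by blast
    show ?thesis
      by (rule recognised_by_reutenauer_mapI[OF proj(2) C(1)]) (auto simp: C(2) reutenauer_map_def)
  qed
  have 3: "recognised_by A (reutenauer_space A X Y) \<Phi> (marked_product L\<^sub>1 a L\<^sub>2)"
    if rec: "recognised_by A X \<phi>\<^sub>1 L\<^sub>1" "recognised_by A Y \<phi>\<^sub>2 L\<^sub>2" and a: "a \<in> A" for L\<^sub>1 a L\<^sub>2
  proof -
    obtain C where C: "clopenin X C" "L\<^sub>1 = {u \<in> \<W>. \<phi>\<^sub>1 (principal \<W> u) \<in> C}"
      using rec(1) recognised_by_iff[OF continuous\<^sub>1] by blast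
    obtain D where D: "clopenin Y D" "L\<^sub>2 = {u \<in> \<W>. \<phi>\<^sub>2 (principal \<W> u) \<in> D}"
      using rec(2) recognised_by_iff[OF continuous\<^sub>2] by blast
    have CD: "clopenin (prod_topology X Y) (C \<times> D)" using C(1) D(1) by (rule clopenin_Times)
    have prod: "marked_product L\<^sub>1 a L\<^sub>2 = factorisations a (C \<times> D)"
      by (simp add: factorisations_Times C(2) D(2))
    show ?thesis
      unfolding prod
    proof (rule recognised_by_reutenauer_mapI[OF component[OF a] clopenin_vietoris_diamond[OF CD]])
      fix w assume w: "w \<in> \<W>"
      note uf = principal_ultrafilter[OF w]
      \<comment> \<open>A word lies in a language iff its principal ultrafilter contains the
        language, so the criterion for ultrafilters specialises to words.\<close>
      have "w \<in> factorisations a (C \<times> D) \<longleftrightarrow> factorisations a (C \<times> D) \<in> principal \<W> w"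
        using factorisations_subset[OF a] by (simp add: principal_def)
      also have "\<dots> \<longleftrightarrow> \<zeta> a (principal \<W> w) \<inter> C \<times> D \<noteq> {}"
        using zeta_meets_clopenin_iff[OF a uf CD] by simp
      also have "\<dots> \<longleftrightarrow> fst (\<Phi> (principal \<W> w)) a \<in> vietoris_diamond (prod_topology X Y) (C \<times> D)"
        using a closedin_zeta[OF a uf] by (simp add: reutenauer_map_def vietoris_diamond_def)
      finally show "w \<in> factorisations a (C \<times> D) \<longleftrightarrow>
        fst (\<Phi> (principal \<W> w)) a \<in> vietoris_diamond (prod_topology X Y) (C \<times> D)" .
    qed (rule factorisations_subset[OF a])
  qed
  have "\<L> \<subseteq> {L. recognised_by A (reutenauer_space A X Y) \<Phi> L}"
    unfolding reutenauer_algebra_def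
    by (rule hull_minimal)
      (use 1 2 3 algebra_recognised_by[OF continuous_map_beta_reutenauer_map] in auto)
  then show ?thesis using assms by blast
qed

end

theorem theorem5p4:
  fixes A :: "'a set"
    and X :: "'x topology" and M :: "'x monoid" and lact\<^sub>1 ract\<^sub>1 :: "'x \<Rightarrow> 'x \<Rightarrow> 'x"
    and Y :: "'y topology" and N :: "'y monoid" and lact\<^sub>2 ract\<^sub>2 :: "'y \<Rightarrow> 'y \<Rightarrow> 'y"
    and \<phi>\<^sub>1 :: "'a list set set \<Rightarrow> 'x" and \<phi>\<^sub>2 :: "'a list set set \<Rightarrow> 'y"
    and L :: "'a list set"
  assumes "finite A"
    and "boolean_space_internal_monoid X M lact\<^sub>1 ract\<^sub>1"
    and "boolean_space_internal_monoid Y N lact\<^sub>2 ract\<^sub>2"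
    and "internal_monoid_morphism (beta (lists A)) (word_monoid A) X M \<phi>\<^sub>1"
    and "internal_monoid_morphism (beta (lists A)) (word_monoid A) Y N \<phi>\<^sub>2"
    and "L \<subseteq> lists A"
  shows "recognised_by A (reutenauer_space A X Y) (reutenauer_map A X Y \<phi>\<^sub>1 \<phi>\<^sub>2) L \<longleftrightarrow>
         L \<in> reutenauer_algebra A X Y \<phi>\<^sub>1 \<phi>\<^sub>2"
proof -
  interpret X: boolean_space_internal_monoid X M lact\<^sub>1 ract\<^sub>1 by fact
  interpret Y: boolean_space_internal_monoid Y N lact\<^sub>2 ract\<^sub>2 by fact
  interpret recognising_pair A X Y \<phi>\<^sub>1 \<phi>\<^sub>2
    using X.boolean Y.boolean assms(4,5) by unfold_locales (simp_all add: internal_monoid_morphism_def)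
  show ?thesis
    using recognised_imp_in_reutenauer_algebra in_reutenauer_algebra_imp_recognised by blast
qed

end
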